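(* Consider the problem $\min_{x\in\operatorname{dom}\Psi}[\tilde f(x)=f(x)+\Psi(x)]$, where $f$ is convex with $\operatorname{dom} f=\mathbb{E}$ and satisfies the Regularity Assumption, and $\Psi$ is a closed convex function; let $x^*$ be an optimal solution. Let the method UFGM (described in the context) be run with $\epsilon>0$ and $0<L_0\le2\gamma_f(\epsilon)$, and let $D=\beta_d(x_0,x^* )$. 1. If for some $k\ge0$ we have $A_{k+1}\le\frac2\epsilon D$, then $$\frac2{\tau_k}\,\hat\mu\Big(2\,\tau_k^{3/2}D^{1/2}\Big)\ \ge\ \epsilon.$$ 2. Let the number of iterations $k\ge0$ satisfy $$(k+1)\,\hat\mu\bigg(2\Big(\frac2{k+1}\Big)^{3/2}D^{1/2}\bigg)\ \le\ \epsilon.$$ Then $A_{k+1}\ge\frac2\epsilon D$ and $\tilde f(y_{k+1})-\tilde f(x^* )\le\epsilon$.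
   Context: $\mathbb{E}$ is a finite-dimensional real linear space with dual $\mathbb{E}^*$; $\langle g,x\rangle$ is the value of $g\in\mathbb{E}^*$ at $x$; $\|\cdot\|$ is an arbitrary fixed norm on $\mathbb{E}$. $f:\mathbb{E}\to\mathbb{R}$ is convex and not affine; $\nabla f(x)\in\partial f(x)$ is its gradient (subgradient). $\Psi$ is closed convex with $\operatorname{dom}\Psi\subseteq\mathbb{E}$, $\operatorname{int}(\operatorname{dom}\Psi)\ne\emptyset$. Global Curvature Bound: $\hat\mu(t)=\sup\big\{\frac{\alpha f(x)+(1-\alpha)f(y)-f(\alpha x+(1-\alpha)y)}{\alpha(1-\alpha)}:\ x,y\in\mathbb{E},\ \alpha\in(0,1),\ \|x-y\|\le t\big\}$, $t\ge0$. Regularity Assumption: $\hat\mu(t)<+\infty$ for all $t\ge0$ and $\lim_{\tau\to+0}\frac1\tau\hat\mu(\tau)=0$. The complexity gauge $s_f$ is the inverse function of $\hat\mu$: $\hat\mu(s_f(\epsilon))=\epsilon$, $\epsilon\ge0$. For $t>0$: $\gamma_f(t)=t/s_f^2(t/2)$. Prox-function: $d$ is a differentiable convex function on $\operatorname{dom}\Psi$ with $d(y)\ge d(x)+\langle\nabla d(x),y-x\rangle+\frac12\|y-x\|^2$ for $x\in\operatorname{int}(\operatorname{dom}\Psi)$, $y\in\operatorname{dom}\Psi$; $x_0=\operatorname{arg\,min}_{x\in\operatorname{dom}\Psi}d(x)$ and $d(x_0)=0$. Bregman distance: $\beta_d(x,y)=d(y)-d(x)-\langle\nabla d(x),y-x\rangle$.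 The auxiliary minimization problems below are assumed to be solvable. Universal Fast Gradient Method (UFGM). Choose $L_0>0$, $\epsilon>0$. Define $\phi_0(x)=\beta_d(x_0,x)$, $y_0=x_0$, $A_0=0$. For $k\ge0$ do: 1. Find $v_k=\operatorname{arg\,min}_{x\in\operatorname{dom}\Psi}\phi_k(x)$. 2. Find the smallest integer $i_k\ge0$ such that the coefficient $a_{k+1,i_k}>0$ computed from $a_{k+1,i_k}^2=\frac1{2^{i_k}L_k}(A_k+a_{k+1,i_k})$ and used in the definitions $A_{k+1,i_k}=A_k+a_{k+1,i_k}$, $\tau_{k,i_k}=a_{k+1,i_k}/A_{k+1,i_k}$, $x_{k+1,i_k}=\tau_{k,i_k}v_k+(1-\tau_{k,i_k})y_k$, $\hat x_{k+1,i_k}=\operatorname{arg\,min}_{y\in\operatorname{dom}\Psi}\{\beta_d(v_k,y)+a_{k+1,i_k}[\langle\nabla f(x_{k+1,i_k}),y\rangle+\Psi(y)]\}$, $y_{k+1,i_k}=\tau_{k,i_k}\hat x_{k+1,i_k}+(1-\tau_{k,i_k})y_k$, ensures $$f(y_{k+1,i_k})\le f(x_{k+1,i_k})+\langle\nabla f(x_{k+1,i_k}),y_{k+1,i_k}-x_{k+1,i_k}\rangle+2^{i_k-1}L_k\|y_{k+1,i_k}-x_{k+1,i_k}\|^2+\frac\epsilon2\tau_{k,i_k}.$$ 3. Set $x_{k+1}=x_{k+1,i_k}$, $y_{k+1}=y_{k+1,i_k}$, $a_{k+1}=a_{k+1,i_k}$, $\tau_k=\tau_{k,i_k}$, $A_{k+1}=A_k+a_{k+1}$,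 $L_{k+1}=2^{i_k}L_k$, and $\phi_{k+1}(x)=\phi_k(x)+a_{k+1}[f(x_{k+1})+\langle\nabla f(x_{k+1}),x-x_{k+1}\rangle+\Psi(x)]$. *)

theory Defs
  imports "HOL-Analysis.Analysis"
begin

(* The space is a type of class real_normed_vector, assumed finite-dimensional; its topology is then
   the standard one and every linear functional is bounded, so the dual space is the type of
   bounded linear maps into the reals. *)
definition finite_dimensional :: "'a::real_vector itself \<Rightarrow> bool" where
  "finite_dimensional _ \<longleftrightarrow> (\<exists>B::'a set. finite B \<and> span B = UNIV)"

definition is_affine :: "('a::real_normed_vector \<Rightarrow> real) \<Rightarrow> bool" where
  "is_affine f \<longleftrightarrow> (\<exists>(g :: 'a \<Rightarrow>\<^sub>L real) c. \<forall>x. f x = blinfun_apply g x + c)"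

definition subdifferential :: "('a::real_normed_vector \<Rightarrow> real) \<Rightarrow> 'a \<Rightarrow> ('a \<Rightarrow>\<^sub>L real) set" where
  "subdifferential f x = {g. \<forall>y. f x + blinfun_apply g (y - x) \<le> f y}"

(* A function with effective domain Q is given by Q and its finite values on Q. *)
definition closed_convex_on :: "'a::real_normed_vector set \<Rightarrow> ('a \<Rightarrow> real) \<Rightarrow> bool" where
  "closed_convex_on Q \<Psi> \<longleftrightarrow> convex_on Q \<Psi> \<and> closed (epigraph Q \<Psi>)"

(* Only meaningful for t \<ge> 0. *)
definition curvature_bound :: "('a::real_normed_vector \<Rightarrow> real) \<Rightarrow> real \<Rightarrow> ereal" where
  "curvature_bound f t =
     Sup {ereal ((\<alpha> * f x + (1 - \<alpha>) * f y - f (\<alpha> *\<^sub>R x + (1 - \<alpha>) *\<^sub>R y)) / (\<alpha> * (1 - \<alpha>))) | x y \<alpha>.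
            0 < \<alpha> \<and> \<alpha> < 1 \<and> norm (x - y) \<le> t}"

definition regularity_assumption :: "('a::real_normed_vector \<Rightarrow> real) \<Rightarrow> bool" where
  "regularity_assumption f \<longleftrightarrow>
     (\<forall>t\<ge>0. curvature_bound f t < \<infinity>) \<and>
     ((\<lambda>\<tau>. ereal (1 / \<tau>) * curvature_bound f \<tau>) \<longlongrightarrow> 0) (at_right 0)"

(* For f convex, not affine and regular, curvature_bound f is a bijection from the nonnegative reals
   onto the nonnegative finite extended reals, so this inverse is well defined for e \<ge> 0. *)
definition complexity_gauge :: "('a::real_normed_vector \<Rightarrow> real) \<Rightarrow> real \<Rightarrow> real" where
  "complexity_gauge f e = the_inv_into {0..} (curvature_bound f) (ereal e)"

definition gamma_gauge :: "('a::real_normed_vector \<Rightarrow> real) \<Rightarrow> real \<Rightarrow> real" where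
  "gamma_gauge f t = t / (complexity_gauge f (t / 2))\<^sup>2"

(* The derivative is taken within Q, so that the gradient (and the Bregman distance) also makes sense
   at boundary points of Q; it is unique there when Q is convex with nonempty interior. *)
definition prox_function ::
  "'a::real_normed_vector set \<Rightarrow> ('a \<Rightarrow> real) \<Rightarrow> ('a \<Rightarrow> 'a \<Rightarrow>\<^sub>L real) \<Rightarrow> bool" where
  "prox_function Q d grad_d \<longleftrightarrow>
     convex_on Q d \<and>
     (\<forall>x\<in>Q. (d has_derivative blinfun_apply (grad_d x)) (at x within Q)) \<and>
     (\<forall>x\<in>interior Q. \<forall>y\<in>Q.
        d y \<ge> d x + blinfun_apply (grad_d x) (y - x) + 1 / 2 * (norm (y - x))\<^sup>2)"

definition bregman ::
  "('a::real_normed_vector \<Rightarrow> real) \<Rightarrow> ('a \<Rightarrow> 'a \<Rightarrow>\<^sub>L real) \<Rightarrow> 'a \<Rightarrow> 'a \<Rightarrow> real" where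
  "bregman d grad_d x y = d y - d x - blinfun_apply (grad_d x) (y - x)"

(* The quantities a, \<tau>, x, xh, y' computed in trial j of the line search, starting from
   v, y, A, L (the current v_k, y_k, A_k, L_k). *)
definition ufgm_trial where
  "ufgm_trial grad_f \<Psi> Q d grad_d v y A L j a \<tau> x xh y' \<longleftrightarrow>
     (a::real) > 0 \<and> a\<^sup>2 = 1 / (2 ^ j * L) * (A + a) \<and>
     \<tau> = a / (A + a) \<and>
     x = \<tau> *\<^sub>R v + (1 - \<tau>) *\<^sub>R y \<and>
     is_arg_min (\<lambda>z. bregman d grad_d v z + a * (blinfun_apply (grad_f x) z + \<Psi> z)) (\<lambda>z. z \<in> Q) xh \<and>
     y' = \<tau> *\<^sub>R xh + (1 - \<tau>) *\<^sub>R y"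

definition ufgm_accept where
  "ufgm_accept f grad_f \<epsilon> L j \<tau> x y' \<longleftrightarrow>
     f y' \<le> f x + blinfun_apply (grad_f x) (y' - x)
            + 2 powi (int j - 1) * L * (norm (y' - x))\<^sup>2 + \<epsilon> / 2 * (\<tau>::real)"

(* The doubly indexed aT, \<tau>T, xT, xhT, yT are the trial quantities: aT k j is a_{k+1,j},
   \<tau>T k j is \<tau>_{k,j}, and similarly for the others. They are constrained only for the
   trials j \<le> i k that the method performs, and a 0, x 0 are not constrained at all.
   That all these objects exist includes the solvability of the auxiliary problems. *)
definition ufgm_run ::
  "('a::real_normed_vector \<Rightarrow> real) \<Rightarrow> ('a \<Rightarrow> 'a \<Rightarrow>\<^sub>L real) \<Rightarrow> ('a \<Rightarrow> real) \<Rightarrow> 'a set \<Rightarrow>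
   ('a \<Rightarrow> real) \<Rightarrow> ('a \<Rightarrow> 'a \<Rightarrow>\<^sub>L real) \<Rightarrow> 'a \<Rightarrow> real \<Rightarrow> real \<Rightarrow>
   (nat \<Rightarrow> 'a \<Rightarrow> real) \<Rightarrow> (nat \<Rightarrow> 'a) \<Rightarrow> (nat \<Rightarrow> nat) \<Rightarrow>
   (nat \<Rightarrow> nat \<Rightarrow> real) \<Rightarrow> (nat \<Rightarrow> nat \<Rightarrow> real) \<Rightarrow>
   (nat \<Rightarrow> nat \<Rightarrow> 'a) \<Rightarrow> (nat \<Rightarrow> nat \<Rightarrow> 'a) \<Rightarrow> (nat \<Rightarrow> nat \<Rightarrow> 'a) \<Rightarrow>
   (nat \<Rightarrow> real) \<Rightarrow> (nat \<Rightarrow> real) \<Rightarrow> (nat \<Rightarrow> 'a) \<Rightarrow> (nat \<Rightarrow> 'a) \<Rightarrow>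
   (nat \<Rightarrow> real) \<Rightarrow> (nat \<Rightarrow> real) \<Rightarrow> bool" where
  "ufgm_run f grad_f \<Psi> Q d grad_d x0 L0 \<epsilon> \<phi> v i aT \<tau>T xT xhT yT a \<tau> x y A L \<longleftrightarrow>
     (\<forall>z. \<phi> 0 z = bregman d grad_d x0 z) \<and> y 0 = x0 \<and> A 0 = 0 \<and> L 0 = L0 \<and>
     (\<forall>k.
        is_arg_min (\<phi> k) (\<lambda>z. z \<in> Q) (v k) \<and>
        (\<forall>j\<le>i k. ufgm_trial grad_f \<Psi> Q d grad_d (v k) (y k) (A k) (L k) j
                    (aT k j) (\<tau>T k j) (xT k j) (xhT k j) (yT k j)) \<and>
        ufgm_accept f grad_f \<epsilon> (L k) (i k) (\<tau>T k (i k)) (xT k (i k)) (yT k (i k)) \<and>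
        (\<forall>j<i k. \<not> ufgm_accept f grad_f \<epsilon> (L k) j (\<tau>T k j) (xT k j) (yT k j)) \<and>
        x (Suc k) = xT k (i k) \<and> y (Suc k) = yT k (i k) \<and>
        a (Suc k) = aT k (i k) \<and> \<tau> k = \<tau>T k (i k) \<and>
        A (Suc k) = A k + a (Suc k) \<and> L (Suc k) = 2 ^ i k * L k \<and>
        (\<forall>z. \<phi> (Suc k) z = \<phi> k z + a (Suc k) *
                (f (x (Suc k)) + blinfun_apply (grad_f (x (Suc k))) (z - x (Suc k)) + \<Psi> z)))"

end

theory Submission
  imports Defs
begin

text \<open>
  Write \<open>\<mu>\<close> for the global curvature bound and \<open>\<gamma>\<close> for the gauge
  \<open>t / s(t/2)\<^sup>2\<close>, \<open>s\<close> being the inverse of \<open>\<mu>\<close>. The proof has two independent halves.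

  The first half bounds the step coefficients. By definition of \<open>\<mu>\<close>, and because its
  regularity at \<open>0\<close> forces every subgradient to be a derivative, the linear model of \<open>f\<close> at a
  point errs at distance \<open>r\<close> by at most \<open>\<mu>(r)\<close> (\<open>linear_model_error\<close>). The key fact on \<open>\<mu>\<close>
  is that \<open>\<mu>(t) / t\<^sup>2\<close> is nonincreasing (\<open>curv_over_square_antimono\<close>): along a line, the
  quotient in the definition of \<open>\<mu>\<close> divided by the squared length of the segment is a second
  divided difference, and a divided difference on far apart nodes is an average of divided
  differences on closer ones. Hence for \<open>r \<ge> s\<close> the error \<open>\<mu>(r)\<close> is at most
  \<open>r\<^sup>2 \<mu>(s) / s\<^sup>2\<close>, and for \<open>r \<le> s\<close> it is at most \<open>\<mu>(s)\<close>; with \<open>\<mu>(s) = \<epsilon> \<tau> / 2\<close> this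
  says that a trial of the line search is accepted as soon as its constant reaches
  \<open>\<gamma>(\<epsilon> \<tau>)\<close>. So the constants of the method never exceed \<open>2 \<gamma>(\<epsilon> \<tau>\<^sub>k)\<close> (\<open>L_le_gamma\<close>).
  Since \<open>\<tau>\<^sub>k\<^sup>2 L\<^bsub>k+1\<^esub> A\<^bsub>k+1\<^esub> = 1\<close>, an upper bound for \<open>A\<^bsub>k+1\<^esub>\<close> is a lower bound for
  \<open>L\<^bsub>k+1\<^esub>\<close>, and comparing it with the gauge gives the first claim. The same identity and the
  monotonicity of \<open>L\<close> give \<open>\<tau>\<^sub>k \<le> 2 / (k + 2)\<close>, which is strictly below \<open>2 / (k + 1)\<close>; since
  \<open>\<mu>(t) / t\<close> is nondecreasing, the hypothesis of the second claim then contradicts the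
  conclusion of the first one, so that \<open>A\<^bsub>k+1\<^esub>\<close> is at least \<open>2 D / \<epsilon>\<close>.

  The second half is the argument of estimating sequences. The functions \<open>\<phi>\<^sub>k\<close> lie below
  \<open>A\<^sub>k (f + \<Psi>)\<close> plus the Bregman distance from \<open>x\<^sub>0\<close> (\<open>estimate_upper\<close>), while the acceptance
  test keeps \<open>A\<^sub>k (f + \<Psi>)(y\<^sub>k) - \<epsilon> A\<^sub>k / 2\<close> below the minimum of \<open>\<phi>\<^sub>k\<close>
  (\<open>estimate_lower\<close>). Comparing both at the solution, the gap at \<open>y\<^sub>k\<close> is at most
  \<open>D / A\<^sub>k + \<epsilon> / 2\<close>, hence at most \<open>\<epsilon>\<close> as soon as \<open>A\<^sub>k \<ge> 2 D / \<epsilon>\<close>.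
\<close>

section \<open>Second divided differences\<close>

text \<open>
  For \<open>u < p < w\<close> this is \<open>(p - u) * (w - p) * (w - u)\<close> times the second divided difference
  \<open>g[u, p, w]\<close>; with denominators cleared, nodes may coincide.
\<close>

definition scaled_divided_difference :: "(real \<Rightarrow> real) \<Rightarrow> real \<Rightarrow> real \<Rightarrow> real \<Rightarrow> real" where
  "scaled_divided_difference g u p w = (w - p) * g u + (p - u) * g w - (w - u) * g p"

definition divided_differences_bounded :: "(real \<Rightarrow> real) \<Rightarrow> real \<Rightarrow> real \<Rightarrow> bool" where
  "divided_differences_bounded g M h \<longleftrightarrow>
     (\<forall>u p w. u \<le> p \<longrightarrow> p \<le> w \<longrightarrow> w - u = h \<longrightarrow>
        scaled_divided_difference g u p w \<le> M * ((p - u) * (w - p) * (w - u)))"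

lemma divided_differences_boundedD:
  "divided_differences_bounded g M h \<Longrightarrow> u \<le> p \<Longrightarrow> p \<le> w \<Longrightarrow> w - u = h \<Longrightarrow>
    scaled_divided_difference g u p w \<le> M * ((p - u) * (w - p) * h)"
  by (auto simp: divided_differences_bounded_def)

text \<open>
  The reason is knot insertion. Let \<open>c = w - h\<close> and \<open>e = u + h\<close>. Then \<open>g[u, p, w]\<close> is the average of
  \<open>g[u, p, e]\<close>, \<open>g[c, p, w]\<close>, \<open>g[u, c, e]\<close> and \<open>g[c, e, w]\<close>, all of spread exactly \<open>h\<close>, with
  weights proportional to \<open>e - p\<close>, \<open>p - c\<close>, \<open>\<delta>\<close> and \<open>\<delta>\<close>. They are nonnegative because \<open>p\<close> lies
  between \<open>c\<close> and \<open>e\<close>.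
\<close>

lemma divided_difference_bound_central:
  assumes bd: "divided_differences_bounded g M h"
    and wu: "w - u = h + \<delta>" and \<delta>: "0 \<le> \<delta>" "\<delta> < h"
    and p: "w - h \<le> p" "p \<le> u + h"
  shows "scaled_divided_difference g u p w \<le> M * ((p - u) * (w - p) * (w - u))"
proof -
  define c e where "c = w - h" and "e = u + h"
  have w: "w = u + h + \<delta>" and c': "c = u + \<delta>" using wu by (auto simp: c_def)
  have N1: "scaled_divided_difference g u p e \<le> M * ((p - u) * (e - p) * h)"
    using divided_differences_boundedD[OF bd, of u p e] p \<delta> by (simp add: e_def w)
  have N2: "scaled_divided_difference g c p w \<le> M * ((p - c) * (w - p) * h)"
    using divided_differences_boundedD[OF bd, of c p w] p \<delta> by (simp add: c_def w)
  have N3: "scaled_divided_difference g u c e \<le> M * (\<delta> * (h - \<delta>) * h)"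
    using divided_differences_boundedD[OF bd, of u c e] \<delta> by (simp add: e_def c')
  have N4: "scaled_divided_difference g c e w \<le> M * (\<delta> * (h - \<delta>) * h)"
    using divided_differences_boundedD[OF bd, of c e w] \<delta> by (simp add: e_def c' w algebra_simps)
  have pos: "0 \<le> p - u" "0 \<le> w - p" "0 < h - \<delta>" "0 < h" using p \<delta> w by auto
  have "(h - \<delta>) * (h * scaled_divided_difference g u p w) =
     (h - \<delta>) * ((w - p) * scaled_divided_difference g u p e
        + (p - u) * scaled_divided_difference g c p w)
      + (w - p) * (p - u) * (scaled_divided_difference g u c e + scaled_divided_difference g c e w)"
    unfolding scaled_divided_difference_def by (simp add: e_def c' w) algebra
  also have "\<dots> \<le> (h - \<delta>) * ((w - p) * (M * ((p - u) * (e - p) * h)) + (p - u) * (M * ((p - c) * (w - p) * h)))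
      + (w - p) * (p - u) * (M * (\<delta> * (h - \<delta>) * h) + M * (\<delta> * (h - \<delta>) * h))"
    using pos by (intro add_mono mult_left_mono N1 N2 N3 N4) auto
  also have "\<dots> = (h - \<delta>) * (h * (M * ((p - u) * (w - p) * (w - u))))"
    unfolding e_def c' w by algebra
  finally show ?thesis using pos by simp
qed

text \<open>
  When \<open>p\<close> is left of \<open>c\<close>, inserting the single knot \<open>e\<close> expresses \<open>g[u, p, w]\<close> by
  \<open>g[u, p, e]\<close>, of spread \<open>h\<close>, and \<open>g[p, e, w]\<close>, whose middle node is again central. The case
  of \<open>p\<close> right of \<open>e\<close> is the mirror image.
\<close>

lemma divided_difference_bound_near:
  assumes bd: "divided_differences_bounded g M h"
    and wu: "w - u = h + \<delta>" and \<delta>: "0 \<le> \<delta>" "\<delta> < h"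
    and p: "u \<le> p" "p \<le> w"
  shows "scaled_divided_difference g u p w \<le> M * ((p - u) * (w - p) * (w - u))"
proof -
  define c e where "c = w - h" and "e = u + h"
  have w: "w = u + h + \<delta>" and c': "c = u + \<delta>" using wu by (auto simp: c_def)
  consider "c \<le> p \<and> p \<le> e" | "p < c" | "e < p" by linarith
  then show ?thesis
  proof cases
    case 1
    then show ?thesis using divided_difference_bound_central[OF bd wu \<delta>] by (simp add: c_def e_def)
  next
    case 2
    have N1: "scaled_divided_difference g u p e \<le> M * ((p - u) * (e - p) * h)"
      using divided_differences_boundedD[OF bd, of u p e] p 2 \<delta> by (simp add: e_def c')
    have N2: "scaled_divided_difference g p e w \<le> M * ((e - p) * (w - e) * (w - p))"
      using divided_difference_bound_central[OF bd, of w p "u + \<delta> - p" e] p 2 \<delta> by (simp add: e_def c' w)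
    have pos: "0 \<le> p - u" "0 \<le> w - p" "0 < e - p" using p 2 \<delta> w c' e_def by auto
    have "(e - p) * scaled_divided_difference g u p w
        = (w - p) * scaled_divided_difference g u p e + (p - u) * scaled_divided_difference g p e w"
      unfolding scaled_divided_difference_def by algebra
    also have "\<dots> \<le> (w - p) * (M * ((p - u) * (e - p) * h)) + (p - u) * (M * ((e - p) * (w - e) * (w - p)))"
      using pos by (intro add_mono mult_left_mono N1 N2) auto
    also have "\<dots> = (e - p) * (M * ((p - u) * (w - p) * (w - u)))"
      unfolding e_def w by algebra
    finally show ?thesis using pos by simp
  next
    case 3
    have N1: "scaled_divided_difference g c p w \<le> M * ((p - c) * (w - p) * h)"
      using divided_differences_boundedD[OF bd, of c p w] p 3 \<delta> by (simp add: e_def c' w)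
    have N2: "scaled_divided_difference g u c p \<le> M * ((c - u) * (p - c) * (p - u))"
      using divided_difference_bound_central[OF bd, of p u "p - u - h" c] p 3 \<delta> by (simp add: e_def c' w)
    have pos: "0 \<le> p - u" "0 \<le> w - p" "0 < p - c" using p 3 \<delta> w c' e_def by auto
    have "(p - c) * scaled_divided_difference g u p w
        = (w - p) * scaled_divided_difference g u c p + (p - u) * scaled_divided_difference g c p w"
      unfolding scaled_divided_difference_def by algebra
    also have "\<dots> \<le> (w - p) * (M * ((c - u) * (p - c) * (p - u))) + (p - u) * (M * ((p - c) * (w - p) * h))"
      using pos by (intro add_mono mult_left_mono N1 N2) auto
    also have "\<dots> = (p - c) * (M * ((p - u) * (w - p) * (w - u)))"
      unfolding c' w by algebra
    finally show ?thesis using pos by simp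
  qed
qed

text \<open>
  The previous lemma requires \<open>\<delta> < h\<close>, that is, a spread below \<open>2 * h\<close>; enlarging the spread
  repeatedly by the factor \<open>3/2\<close> stays within this range and reaches every larger spread.
\<close>

lemma divided_differences_bounded_wider:
  assumes bd: "divided_differences_bounded g M h" and h: "0 < h" "h \<le> l"
  shows "divided_differences_bounded g M l"
proof -
  have *: "divided_differences_bounded g M l" if "h \<le> l" "l \<le> (3/2) ^ n * h" for n l
    using that
  proof (induction n arbitrary: l)
    case 0
    then show ?case using bd by simp
  next
    case (Suc n)
    show ?case
    proof (cases "l \<le> (3/2) ^ n * h")
      case True
      then show ?thesis using Suc by blast
    next
      case False
      (* The bound at spread k is known already, and l < 2 * k is within reach of one extension. *)
      define k where "k = max h (l * (2/3))"
      have k: "h \<le> k" "k \<le> (3/2) ^ n * h" "k \<le> l" "l < 2 * k"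
        using Suc.prems h False by (auto simp: k_def max_def)
      show ?thesis unfolding divided_differences_bounded_def
        using divided_difference_bound_near[OF Suc.IH[OF k(1,2)], of _ _ "l - k"] k by auto
    qed
  qed
  obtain n where "l / h < (3/2) ^ n" using real_arch_pow[of "3/2" "l/h"] by auto
  then have "l \<le> (3/2) ^ n * h" using h by (simp add: field_simps)
  then show ?thesis using * h by blast
qed

section \<open>The global curvature bound\<close>

text \<open>Under regularity no value is lost at nonnegative arguments (\<open>curvature_bound_eq\<close>).\<close>

definition curv :: "('a::real_normed_vector \<Rightarrow> real) \<Rightarrow> real \<Rightarrow> real" where
  "curv f t = real_of_ereal (curvature_bound f t)"

definition jensen_gap :: "('a::real_vector \<Rightarrow> real) \<Rightarrow> real \<Rightarrow> 'a \<Rightarrow> 'a \<Rightarrow> real" where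
  "jensen_gap f \<alpha> x y = \<alpha> * f x + (1 - \<alpha>) * f y - f (\<alpha> *\<^sub>R x + (1 - \<alpha>) *\<^sub>R y)"

lemma curvature_bound_nonneg:
  assumes "0 \<le> t" shows "0 \<le> curvature_bound f t"
proof -
  have "ereal 0 \<le> curvature_bound f t"
    unfolding curvature_bound_def
    by (rule Sup_upper) (use assms in \<open>auto intro!: exI[of _ 0] exI[of _ "1/2"] simp: scaleR_left_distrib[symmetric]\<close>)
  then show ?thesis by (simp add: zero_ereal_def)
qed

lemma curvature_bound_eq:
  assumes "regularity_assumption f" "0 \<le> t" shows "curvature_bound f t = ereal (curv f t)"
  using curvature_bound_nonneg[OF assms(2), of f] assms unfolding regularity_assumption_def curv_def
  by (cases "curvature_bound f t") auto

lemma curv_nonneg: "0 \<le> t \<Longrightarrow> 0 \<le> curv f t"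
  using curvature_bound_nonneg[of t f] unfolding curv_def by (simp add: real_of_ereal_pos)

lemma jensen_gap_le:
  assumes reg: "regularity_assumption f" and \<alpha>: "0 < \<alpha>" "\<alpha> < 1" and xy: "norm (x - y) \<le> t"
  shows "jensen_gap f \<alpha> x y \<le> \<alpha> * (1 - \<alpha>) * curv f t"
proof -
  have t: "0 \<le> t" using xy norm_ge_zero order_trans by blast
  have "ereal (jensen_gap f \<alpha> x y / (\<alpha> * (1 - \<alpha>))) \<le> curvature_bound f t"
    unfolding curvature_bound_def jensen_gap_def by (rule Sup_upper) (use assms in blast)
  then show ?thesis using \<alpha> by (simp add: curvature_bound_eq[OF reg t] field_simps)
qed

lemma curv_least:
  assumes reg: "regularity_assumption f" and t: "0 \<le> t"
   and le: "\<And>x y \<alpha>. 0 < \<alpha> \<Longrightarrow> \<alpha> < 1 \<Longrightarrow> norm (x - y) \<le> t \<Longrightarrow> jensen_gap f \<alpha> x y \<le> \<alpha> * (1 - \<alpha>) * M"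
  shows "curv f t \<le> M"
proof -
  have "curvature_bound f t \<le> ereal M" unfolding curvature_bound_def
  proof (rule Sup_least, clarify)
    fix x y :: 'a and \<alpha> :: real assume *: "0 < \<alpha>" "\<alpha> < 1" "norm (x - y) \<le> t"
    have "jensen_gap f \<alpha> x y / (\<alpha> * (1 - \<alpha>)) \<le> M" using le[OF *] * by (simp add: pos_divide_le_eq mult.commute)
    then show "ereal ((\<alpha> * f x + (1 - \<alpha>) * f y - f (\<alpha> *\<^sub>R x + (1 - \<alpha>) *\<^sub>R y)) / (\<alpha> * (1 - \<alpha>))) \<le> ereal M"
      unfolding jensen_gap_def by simp
  qed
  then show ?thesis by (simp add: curvature_bound_eq[OF reg t])
qed

lemma curv_mono: "regularity_assumption f \<Longrightarrow> 0 \<le> s \<Longrightarrow> s \<le> t \<Longrightarrow> curv f s \<le> curv f t"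
  by (rule curv_least) (auto intro!: jensen_gap_le)

text \<open>
  So \<open>\<mu>(t) / t\<close> is nondecreasing: blowing up the segment from \<open>x\<close> to \<open>y\<close> by the factor \<open>1 / s\<close>
  about the intermediate point \<open>z\<close> enlarges the gap of Jensen's inequality at least by \<open>1 / s\<close>,
  since the slopes of a convex function seen from \<open>z\<close> increase along each ray.
\<close>

lemma curv_scale_le:
  assumes reg: "regularity_assumption f" and cvx: "convex_on UNIV f" and s: "0 < s" "s \<le> 1" and t: "0 \<le> t"
  shows "curv f (s * t) \<le> s * curv f t"
proof (rule curv_least[OF reg])
  fix x y :: 'a and \<alpha> :: real assume \<alpha>: "0 < \<alpha>" "\<alpha> < 1" and xy: "norm (x - y) \<le> s * t"
  define z where "z = \<alpha> *\<^sub>R x + (1 - \<alpha>) *\<^sub>R y"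
  define X Y where "X = z + (1/s) *\<^sub>R (x - z)" and "Y = z + (1/s) *\<^sub>R (y - z)"
  have XY: "X - Y = (1/s) *\<^sub>R (x - y)" by (simp add: X_def Y_def algebra_simps)
  have fx: "f x \<le> (1 - s) * f z + s * f X" and fy: "f y \<le> (1 - s) * f z + s * f Y"
    using convex_onD[OF cvx, of s z X] convex_onD[OF cvx, of s z Y] s
    by (simp_all add: X_def Y_def algebra_simps)
  have z: "\<alpha> *\<^sub>R X + (1 - \<alpha>) *\<^sub>R Y = z"
  proof -
    have "\<alpha> *\<^sub>R X + (1 - \<alpha>) *\<^sub>R Y = Y + \<alpha> *\<^sub>R (X - Y)"
      by (simp add: algebra_simps)
    also have "\<dots> = z + (1/s) *\<^sub>R (y + \<alpha> *\<^sub>R (x - y) - z)"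
      unfolding XY by (simp add: Y_def scaleR_right_distrib scaleR_right_diff_distrib mult.commute)
    also have "y + \<alpha> *\<^sub>R (x - y) = z" by (simp add: z_def algebra_simps)
    finally have "\<alpha> *\<^sub>R X + (1 - \<alpha>) *\<^sub>R Y = z + (1/s) *\<^sub>R (z - z)" .
    then show ?thesis by simp
  qed
  have "norm (X - Y) = norm (x - y) / s" unfolding XY norm_scaleR using s by simp
  then have "norm (X - Y) \<le> t" using xy s by (simp add: pos_divide_le_eq mult.commute)
  then have g: "jensen_gap f \<alpha> X Y \<le> \<alpha> * (1 - \<alpha>) * curv f t" using jensen_gap_le[OF reg \<alpha>] by blast
  have "jensen_gap f \<alpha> x y = \<alpha> * f x + (1 - \<alpha>) * f y - f z" by (simp add: jensen_gap_def z_def)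
  also have "\<dots> \<le> \<alpha> * ((1 - s) * f z + s * f X) + (1 - \<alpha>) * ((1 - s) * f z + s * f Y) - f z"
    using \<alpha> by (intro diff_right_mono add_mono mult_left_mono fx fy) auto
  also have "\<dots> = s * jensen_gap f \<alpha> X Y" unfolding jensen_gap_def z by (simp add: algebra_simps)
  also have "\<dots> \<le> s * (\<alpha> * (1 - \<alpha>) * curv f t)" using g s by simp
  finally show "jensen_gap f \<alpha> x y \<le> \<alpha> * (1 - \<alpha>) * (s * curv f t)" by (simp add: mult_ac)
qed (use s t in simp)

text \<open>
  On a segment of length \<open>l\<close>, parametrised by arc length, the gap of Jensen's inequality divided
  by \<open>\<alpha> * (1 - \<alpha>)\<close> is \<open>l\<^sup>2\<close> times a second divided difference of spread \<open>l\<close>. A segment no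
  longer than \<open>T\<close> but longer than \<open>t\<close> is thus covered by the bound at spread \<open>t\<close>.
\<close>

lemma curv_over_square_antimono:
  assumes reg: "regularity_assumption f" and t: "0 < t" "t \<le> T"
  shows "curv f T / T\<^sup>2 \<le> curv f t / t\<^sup>2"
proof -
  define M where "M = curv f t / t\<^sup>2"
  have M0: "0 \<le> M" using curv_nonneg[of t f] t by (simp add: M_def)
  have "curv f T \<le> M * T\<^sup>2"
  proof (rule curv_least[OF reg])
    fix x y :: 'a and \<alpha> :: real assume \<alpha>: "0 < \<alpha>" "\<alpha> < 1" and xy: "norm (x - y) \<le> T"
    show "jensen_gap f \<alpha> x y \<le> \<alpha> * (1 - \<alpha>) * (M * T\<^sup>2)"
    proof (cases "norm (x - y) \<le> t")
      case True
      have "jensen_gap f \<alpha> x y \<le> \<alpha> * (1 - \<alpha>) * (M * t\<^sup>2)"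
        using jensen_gap_le[OF reg \<alpha> True] t by (simp add: M_def)
      also have "\<dots> \<le> \<alpha> * (1 - \<alpha>) * (M * T\<^sup>2)"
        using \<alpha> t M0 by (intro mult_left_mono power_mono) auto
      finally show ?thesis .
    next
      case False
      define l where "l = norm (x - y)"
      define g where "g = (\<lambda>u. f (y + (u / l) *\<^sub>R (x - y)))"
      have l: "t < l" "0 < l" "l \<le> T" using False t xy by (auto simp: l_def)
      have "divided_differences_bounded g M t" unfolding divided_differences_bounded_def
      proof (intro allI impI)
        fix u p w assume up: "u \<le> p" and pw: "p \<le> w" and wu: "w - u = t"
        show "scaled_divided_difference g u p w \<le> M * ((p - u) * (w - p) * (w - u))"
        proof (cases "u < p \<and> p < w")
          case True
          define \<beta> where "\<beta> = (p - u) / t"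
          have \<beta>: "0 < \<beta>" "\<beta> < 1" using True wu t by (auto simp: \<beta>_def)
          have pu: "p - u = \<beta> * t" "w - p = (1 - \<beta>) * t"
            using wu t by (auto simp: \<beta>_def field_simps)
          let ?X = "y + (w / l) *\<^sub>R (x - y)" and ?Y = "y + (u / l) *\<^sub>R (x - y)"
          have "?X - ?Y = ((w - u) / l) *\<^sub>R (x - y)" by (simp add: scaleR_left_diff_distrib diff_divide_distrib)
          then have "norm (?X - ?Y) = t" using l t unfolding wu by (simp add: l_def)
          then have G: "jensen_gap f \<beta> ?X ?Y \<le> \<beta> * (1 - \<beta>) * curv f t" using jensen_gap_le[OF reg \<beta>] by simp
          have pe: "p = \<beta> * w + (1 - \<beta>) * u" using pu wu by algebra
          have mid: "\<beta> *\<^sub>R ?X + (1 - \<beta>) *\<^sub>R ?Y = y + (p / l) *\<^sub>R (x - y)"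
            unfolding pe by (simp add: algebra_simps add_divide_distrib diff_divide_distrib)
          have "scaled_divided_difference g u p w = t * jensen_gap f \<beta> ?X ?Y"
            unfolding scaled_divided_difference_def pu wu jensen_gap_def mid by (simp add: g_def algebra_simps)
          also have "\<dots> \<le> t * (\<beta> * (1 - \<beta>) * curv f t)" using G t by simp
          also have "\<dots> = M * ((p - u) * (w - p) * (w - u))"
            unfolding pu wu M_def using t by (simp add: field_simps power2_eq_square)
          finally show ?thesis .
        next
          case False
          then have "p = u \<or> p = w" using up pw by auto
          then show ?thesis by (auto simp: scaled_divided_difference_def)
        qed
      qed
      then have "divided_differences_bounded g M l" using divided_differences_bounded_wider l t by auto
      from divided_differences_boundedD[OF this, of 0 "\<alpha> * l" l]
      have "scaled_divided_difference g 0 (\<alpha> * l) l \<le> M * (\<alpha> * l * (l - \<alpha> * l) * l)"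
        using \<alpha> l by simp
      moreover have "scaled_divided_difference g 0 (\<alpha> * l) l = l * jensen_gap f \<alpha> x y"
        using l unfolding scaled_divided_difference_def jensen_gap_def by (simp add: g_def algebra_simps)
      ultimately have "l * jensen_gap f \<alpha> x y \<le> l * (\<alpha> * (1 - \<alpha>) * (M * l\<^sup>2))"
        by (simp add: algebra_simps power2_eq_square)
      then have "jensen_gap f \<alpha> x y \<le> \<alpha> * (1 - \<alpha>) * (M * l\<^sup>2)" using l by simp
      also have "\<dots> \<le> \<alpha> * (1 - \<alpha>) * (M * T\<^sup>2)"
        using \<alpha> l M0 by (intro mult_left_mono power_mono) auto
      finally show ?thesis .
    qed
  qed (use t in simp)
  then show ?thesis using t by (simp add: M_def divide_simps mult_ac)
qed

text \<open>
  A zero of \<open>\<mu>\<close> at a positive argument spreads to all larger ones, because \<open>\<mu>(t) / t\<^sup>2\<close> is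
  nonincreasing. Then \<open>f(0)\<close> is at least the mean of \<open>f(y)\<close> and \<open>f(-y)\<close>, so the supporting affine
  function at \<open>0\<close>, which lies below \<open>f\<close> at both points, must agree with \<open>f\<close> there.
\<close>

lemma curv_pos:
  assumes reg: "regularity_assumption f" and na: "\<not> is_affine f"
    and g: "g \<in> subdifferential f 0" and t: "0 < t"
  shows "0 < curv f t"
proof (rule ccontr)
  assume "\<not> 0 < curv f t"
  then have 0: "curv f t = 0" using curv_nonneg[of t f] t by simp
  have "f y = blinfun_apply g y + f 0" for y
  proof -
    define T where "T = max t (norm (y - - y))"
    have T: "t \<le> T" "0 < T" "norm (y - - y) \<le> T" using t by (auto simp: T_def)
    have "curv f T / T\<^sup>2 \<le> 0" using curv_over_square_antimono[OF reg t T(1)] 0 by simp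
    then have "curv f T \<le> 0" using T by (simp add: divide_le_0_iff)
    then have "jensen_gap f (1/2) y (- y) \<le> 0"
      using jensen_gap_le[OF reg _ _ T(3), of "1/2"] by simp
    then have "f y + f (- y) \<le> 2 * f 0" by (simp add: jensen_gap_def)
    moreover have "f 0 + g y \<le> f y" "f 0 - g y \<le> f (- y)"
      using g by (auto simp: subdifferential_def blinfun.minus_right dest: spec[of _ y] spec[of _ "- y"])
    ultimately show ?thesis by simp
  qed
  then show False using na unfolding is_affine_def by blast
qed

text \<open>
  As \<open>\<mu>\<close> is positive, the monotone quotients \<open>\<mu>(t) / t\<close> and \<open>\<mu>(t) / t\<^sup>2\<close> make it strictly
  increasing and continuous on the positive reals, with limits \<open>0\<close> and infinity, so that the
  inverse defining the gauge exists there.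
\<close>

lemma complexity_gauge_inverse:
  assumes reg: "regularity_assumption f" and cvx: "convex_on UNIV f" and na: "\<not> is_affine f"
    and g: "g \<in> subdifferential f 0" and e: "0 < e"
  shows "0 < complexity_gauge f e" "curv f (complexity_gauge f e) = e"
proof -
  note pos = curv_pos[OF reg na g]
  have strict: "curv f s < curv f t" if "0 < s" "s < t" for s t
  proof -
    have "curv f s \<le> (s / t) * curv f t" using curv_scale_le[OF reg cvx, of "s/t" t] that by simp
    also have "\<dots> < curv f t" using that pos[of t] by (simp add: field_simps)
    finally show ?thesis .
  qed
  have z: "curv f 0 \<le> 0"
    by (rule curv_least[OF reg]) (auto simp: jensen_gap_def scaleR_left_distrib[symmetric] algebra_simps)
  have cont: "isCont (curv f) t" if t: "0 < t" for t
  proof -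
    have sq: "min 1 ((s / t)\<^sup>2) * curv f t \<le> curv f s \<and> curv f s \<le> max 1 ((s / t)\<^sup>2) * curv f t"
      if s: "0 < s" for s
    proof (cases "s \<le> t")
      case True
      have "(s / t)\<^sup>2 \<le> 1" using True s t by (simp add: power_le_one)
      moreover have "(s/t)\<^sup>2 * curv f t \<le> curv f s" using curv_over_square_antimono[OF reg s True] s t
        by (simp add: field_simps)
      ultimately show ?thesis using curv_mono[OF reg _ True] s by (simp add: min_def max_def)
    next
      case False
      then have "1 \<le> (s / t)\<^sup>2" using s t by (simp add: one_le_power)
      moreover have "curv f s \<le> (s/t)\<^sup>2 * curv f t" using curv_over_square_antimono[OF reg t, of s] s t False
        by (simp add: field_simps)
      ultimately show ?thesis using curv_mono[OF reg, of t s] t False by (simp add: min_def max_def)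
    qed
    have ev: "\<forall>\<^sub>F s in at t. 0 < s" using t by (rule order_tendstoD(1)[OF tendsto_ident_at])
    show ?thesis unfolding isCont_def
    proof (rule real_tendsto_sandwich)
      show "\<forall>\<^sub>F s in at t. min 1 ((s / t)\<^sup>2) * curv f t \<le> curv f s"
        using ev by eventually_elim (use sq in blast)
      show "\<forall>\<^sub>F s in at t. curv f s \<le> max 1 ((s / t)\<^sup>2) * curv f t"
        using ev by eventually_elim (use sq in blast)
      have "((\<lambda>s. min 1 ((s / t)\<^sup>2) * curv f t) \<longlongrightarrow> min 1 ((t / t)\<^sup>2) * curv f t) (at t)"
        by (intro tendsto_intros) (use t in auto)
      then show "((\<lambda>s. min 1 ((s / t)\<^sup>2) * curv f t) \<longlongrightarrow> curv f t) (at t)" using t by simp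
      have "((\<lambda>s. max 1 ((s / t)\<^sup>2) * curv f t) \<longlongrightarrow> max 1 ((t / t)\<^sup>2) * curv f t) (at t)"
        by (intro tendsto_intros) (use t in auto)
      then show "((\<lambda>s. max 1 ((s / t)\<^sup>2) * curv f t) \<longlongrightarrow> curv f t) (at t)" using t by simp
    qed
  qed
  (* The linear growth bound, taken from the argument 1, yields a bracket for the level e. *)
  define c where "c = curv f 1"
  have c: "0 < c" using pos c_def by simp
  define lo hi where "lo = min 1 (e / c)" and "hi = max 1 (e / c)"
  have lohi: "0 < lo" "lo \<le> 1" "1 \<le> hi" using e c by (auto simp: lo_def hi_def)
  have "curv f lo \<le> lo * c" using curv_scale_le[OF reg cvx, of lo 1] lohi by (simp add: c_def)
  also have "\<dots> \<le> (e / c) * c" using c by (intro mult_right_mono) (auto simp: lo_def)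
  finally have 1: "curv f lo \<le> e" using c by simp
  have "c \<le> (1 / hi) * curv f hi" using curv_scale_le[OF reg cvx, of "1/hi" hi] lohi by (simp add: c_def)
  then have "hi * c \<le> curv f hi" using lohi by (simp add: field_simps)
  moreover have "(e / c) * c \<le> hi * c" using c by (intro mult_right_mono) (auto simp: hi_def)
  ultimately have 2: "e \<le> curv f hi" using c by simp
  have "\<exists>s\<ge>lo. s \<le> hi \<and> curv f s = e"
    using 1 2 lohi by (intro IVT) (auto intro!: cont)
  then obtain s where "lo \<le> s" and s: "curv f s = e" by blast
  then have s: "0 < s" "curv f s = e" using lohi by auto
  have "complexity_gauge f e = s" unfolding complexity_gauge_def the_inv_into_def
  proof (rule the_equality)
    show "s \<in> {0..} \<and> curvature_bound f s = ereal e" using s curvature_bound_eq[OF reg] by simp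
    fix r assume "r \<in> {0..} \<and> curvature_bound f r = ereal e"
    then have r: "0 \<le> r" "curv f r = e" using curvature_bound_eq[OF reg, of r] by auto
    then have "r \<noteq> 0" using z e by auto
    then show "r = s" using strict[of r s] strict[of s r] r s by (cases r s rule: linorder_cases) auto
  qed
  then show "0 < complexity_gauge f e" "curv f (complexity_gauge f e) = e" using s by auto
qed

lemma gamma_gauge_antimono:
  assumes reg: "regularity_assumption f" and cvx: "convex_on UNIV f" and na: "\<not> is_affine f"
    and g: "g \<in> subdifferential f 0" and t: "0 < t" "t \<le> t'"
  shows "gamma_gauge f t' \<le> gamma_gauge f t"
proof -
  let ?s = "complexity_gauge f (t/2)" and ?s' = "complexity_gauge f (t'/2)"
  have s: "0 < ?s" "curv f ?s = t/2" "0 < ?s'" "curv f ?s' = t'/2"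
    using complexity_gauge_inverse[OF reg cvx na g, of "t/2"] complexity_gauge_inverse[OF reg cvx na g, of "t'/2"] t by auto
  have "?s \<le> ?s'"
  proof (rule ccontr)
    assume *: "\<not> ?s \<le> ?s'"
    then have "t' / 2 = t / 2" using curv_mono[OF reg, of ?s' ?s] s t by simp
    then show False using * by simp
  qed
  then show ?thesis using curv_over_square_antimono[OF reg s(1), of ?s'] s by (simp add: gamma_gauge_def field_simps)
qed

text \<open>
  Weight \<open>\<alpha>\<close> on \<open>y\<close> in the definition of \<open>\<mu>\<close> bounds \<open>f(y) - f(x)\<close> by the difference quotient of
  \<open>f\<close> at \<open>x\<close> with step \<open>\<alpha>\<close> and \<open>(1 - \<alpha>) \<mu>(r)\<close>, for \<open>r\<close> the distance of \<open>x\<close> and \<open>y\<close>. A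
  subgradient bounds difference quotients only from below, but it does so in the opposite direction
  as well, and the two quotients differ by at most \<open>\<mu>(2 r \<alpha>) / (2 \<alpha>)\<close>, which vanishes for
  \<open>\<alpha> \<rightarrow> 0\<close> by regularity.
\<close>

lemma linear_model_error:
  assumes reg: "regularity_assumption f" and g: "g \<in> subdifferential f x"
  shows "f y \<le> f x + blinfun_apply g (y - x) + curv f (norm (y - x))"
proof -
  let ?h = "y - x" let ?r = "norm ?h"
  have lim0: "((\<lambda>\<tau>. curv f \<tau> / \<tau>) \<longlongrightarrow> 0) (at_right 0)"
  proof -
    have "((\<lambda>\<tau>. ereal (1 / \<tau>) * curvature_bound f \<tau>) \<longlongrightarrow> ereal 0) (at_right 0)"
      using reg by (simp add: regularity_assumption_def zero_ereal_def)
    moreover have "\<forall>\<^sub>F \<tau> in at_right 0. ereal (1 / \<tau>) * curvature_bound f \<tau> = ereal (curv f \<tau> / \<tau>)"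
      using eventually_at_right_less[of 0] by eventually_elim (simp add: curvature_bound_eq[OF reg])
    ultimately have "((\<lambda>\<tau>. ereal (curv f \<tau> / \<tau>)) \<longlongrightarrow> ereal 0) (at_right 0)"
      by (rule Lim_transform_eventually)
    then show ?thesis by simp
  qed
  show ?thesis
  proof (cases "?r = 0")
    case True
    then show ?thesis using curv_nonneg[of 0 f] by simp
  next
    case False
    have le: "f y - f x - g ?h \<le> (1 - \<alpha>) * curv f ?r + ?r * (curv f (2 * ?r * \<alpha>) / (2 * ?r * \<alpha>))"
      if \<alpha>: "0 < \<alpha>" "\<alpha> < 1" for \<alpha>
    proof -
      let ?z = "x + \<alpha> *\<^sub>R ?h" and ?z' = "x - \<alpha> *\<^sub>R ?h"
      have A: "\<alpha> * f y + (1 - \<alpha>) * f x - f ?z \<le> \<alpha> * (1 - \<alpha>) * curv f ?r"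
        using jensen_gap_le[OF reg \<alpha>, of y x ?r] by (simp add: jensen_gap_def algebra_simps)
      have zz: "?z - ?z' = (2 * \<alpha>) *\<^sub>R ?h" by (simp add: algebra_simps scaleR_2 mult_2 flip: scaleR_scaleR)
      have mid: "(1 / 2) *\<^sub>R ?z + (1 - 1 / 2) *\<^sub>R ?z' = x" by (simp add: scaleR_right_distrib scaleR_right_diff_distrib flip: scaleR_left_distrib)
      have "norm (?z - ?z') = 2 * ?r * \<alpha>" using \<alpha> unfolding zz by simp
      then have "jensen_gap f (1/2) ?z ?z' \<le> 1/4 * curv f (2 * ?r * \<alpha>)"
        using jensen_gap_le[OF reg, of "1/2" ?z ?z' "2 * ?r * \<alpha>"] by simp
      then have "f ?z + f ?z' - 2 * f x \<le> curv f (2 * ?r * \<alpha>) / 2"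
        unfolding jensen_gap_def mid by simp
      moreover have "f x - \<alpha> * g ?h \<le> f ?z'"
        using g[unfolded subdifferential_def, simplified, rule_format, of ?z']
        by (simp add: blinfun.minus_right blinfun.scaleR_right)
      ultimately have C: "f ?z - f x \<le> \<alpha> * g ?h + curv f (2 * ?r * \<alpha>) / 2" by simp
      have "\<alpha> * (f y - f x - g ?h) \<le> \<alpha> * (1 - \<alpha>) * curv f ?r + curv f (2 * ?r * \<alpha>) / 2"
        using A C by (simp add: algebra_simps)
      also have "\<dots> = \<alpha> * ((1 - \<alpha>) * curv f ?r + ?r * (curv f (2 * ?r * \<alpha>) / (2 * ?r * \<alpha>)))"
        using \<alpha> False by (simp add: field_simps)
      finally show ?thesis using \<alpha> by simp
    qed
    have "filterlim (\<lambda>\<alpha>. 2 * ?r * \<alpha>) (at_right 0) (at_right 0)"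
      unfolding filterlim_at
    proof
      show "\<forall>\<^sub>F \<alpha> in at_right 0. 2 * ?r * \<alpha> \<in> {0<..} \<and> 2 * ?r * \<alpha> \<noteq> 0"
        using eventually_at_right_less[of 0] by eventually_elim (use False in auto)
      show "((\<lambda>\<alpha>. 2 * ?r * \<alpha>) \<longlongrightarrow> 0) (at_right 0)"
        by (rule tendsto_eq_intros refl | simp)+
    qed
    from filterlim_compose[OF lim0 this]
    have lim: "((\<lambda>\<alpha>. (1 - \<alpha>) * curv f ?r + ?r * (curv f (2 * ?r * \<alpha>) / (2 * ?r * \<alpha>))) \<longlongrightarrow>
         (1 - 0) * curv f ?r + ?r * 0) (at_right 0)"
      by (intro tendsto_intros)
    have "\<forall>\<^sub>F \<alpha> in at_right (0::real). \<alpha> < 1" using eventually_at_right_real[of 0 1] by (auto elim: eventually_mono)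
    with eventually_at_right_less[of 0]
    have "\<forall>\<^sub>F \<alpha> in at_right 0. f y - f x - g ?h \<le> (1 - \<alpha>) * curv f ?r + ?r * (curv f (2 * ?r * \<alpha>) / (2 * ?r * \<alpha>))"
      by eventually_elim (rule le)
    from tendsto_lowerbound[OF lim this] show ?thesis by simp
  qed
qed

text \<open>
  The gauge as a quadratic majorant of \<open>\<mu>\<close> with tolerance: up to the point \<open>s\<close> with
  \<open>\<mu>(s) = e / 2\<close> the tolerance suffices, and beyond it the decrease of \<open>\<mu>(r) / r\<^sup>2\<close>
  makes the quadratic term with coefficient \<open>\<mu>(s) / s\<^sup>2\<close>, which is half of the gauge, suffice.
\<close>

lemma gauge_quadratic_model:
  assumes reg: "regularity_assumption f" and cvx: "convex_on UNIV f" and na: "\<not> is_affine f"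
    and g0: "g0 \<in> subdifferential f 0" and g: "g \<in> subdifferential f x"
    and e: "0 < e" and M: "gamma_gauge f e \<le> M"
  shows "f y \<le> f x + blinfun_apply g (y - x) + M / 2 * (norm (y - x))\<^sup>2 + e / 2"
proof -
  define s r where "s = complexity_gauge f (e / 2)" and "r = norm (y - x)"
  have s: "0 < s" "curv f s = e / 2" using complexity_gauge_inverse[OF reg cvx na g0, of "e/2"] e by (auto simp: s_def)
  have Ms: "e / s\<^sup>2 \<le> M" using M by (simp add: gamma_gauge_def s_def)
  have M0: "0 \<le> M" using Ms e order_trans[of 0 "e / s\<^sup>2" M] by simp
  have r0: "0 \<le> r" by (simp add: r_def)
  have "curv f r \<le> M / 2 * r\<^sup>2 + e / 2"
  proof (cases "r \<le> s")
    case True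
    then have "curv f r \<le> e / 2" using curv_mono[OF reg r0] s by metis
    then show ?thesis using M0 by (simp add: add_increasing)
  next
    case False
    then have "curv f r \<le> (e / s\<^sup>2) / 2 * r\<^sup>2" using curv_over_square_antimono[OF reg s(1), of r] s r0
      by (simp add: field_simps)
    also have "\<dots> \<le> M / 2 * r\<^sup>2" using Ms by (intro mult_right_mono) auto
    finally show ?thesis using e by simp
  qed
  then show ?thesis using linear_model_error[OF reg g, of y] by (simp add: r_def)
qed

section \<open>Prox-functions and Bregman distances\<close>

lemma convex_interior_segment:
  fixes S :: "'a::real_normed_vector set"
  assumes S: "convex S" and x: "x \<in> S" and z: "z \<in> interior S" and t: "0 < t" "t \<le> 1"
  shows "x + t *\<^sub>R (z - x) \<in> interior S"
proof -
  let ?h = "\<lambda>w. (x - t *\<^sub>R x) + t *\<^sub>R w"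
  have "?h ` interior S \<subseteq> S"
  proof clarify
    fix w assume "w \<in> interior S"
    then have "(1 - t) *\<^sub>R x + t *\<^sub>R w \<in> S"
      using convexD_alt[OF S x, of w t] t interior_subset by auto
    then show "?h w \<in> S" by (simp add: algebra_simps)
  qed
  moreover have "open (?h ` interior S)" using t by (intro open_affinity) auto
  ultimately have "?h ` interior S \<subseteq> interior S" by (rule interior_maximal)
  then have "?h z \<in> interior S" using z by blast
  then show ?thesis by (simp add: algebra_simps)
qed

lemma directional_derivative_within:
  fixes d :: "'a::real_normed_vector \<Rightarrow> real"
  assumes Q: "convex Q" and der: "(d has_derivative blinfun_apply D) (at x within Q)"
    and x: "x \<in> Q" and y: "y \<in> Q"
  shows "((\<lambda>t. (d (x + t *\<^sub>R (y - x)) - d x) / t) \<longlongrightarrow> blinfun_apply D (y - x)) (at_right 0)"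
proof -
  let ?g = "\<lambda>t::real. x + t *\<^sub>R (y - x)"
  have sub: "?g ` {0..1} \<subseteq> Q"
  proof clarify
    fix t :: real assume "t \<in> {0..1}"
    then have "(1 - t) *\<^sub>R x + t *\<^sub>R y \<in> Q" using convexD_alt[OF Q x y] by simp
    then show "?g t \<in> Q" by (simp add: algebra_simps)
  qed
  have "(d has_derivative blinfun_apply D) (at (?g 0) within ?g ` {0..1})"
    using has_derivative_subset[OF der sub] by simp
  moreover have "(?g has_derivative (\<lambda>t. t *\<^sub>R (y - x))) (at 0 within {0..1})"
    by (auto intro!: derivative_eq_intros)
  ultimately have "((\<lambda>t. d (?g t)) has_derivative (\<lambda>t. D (t *\<^sub>R (y - x)))) (at 0 within {0..1})"
    by (rule has_derivative_in_compose[rotated])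
  then have "((\<lambda>t. d (?g t)) has_real_derivative D (y - x)) (at 0 within {0..1})"
    unfolding has_field_derivative_def by (simp add: blinfun.scaleR_right mult_commute_abs)
  then show ?thesis
    unfolding has_field_derivative_iff by (simp add: at_within_Icc_at_right)
qed

lemma eventually_at_right_01: "\<forall>\<^sub>F t in at_right (0::real). 0 < t \<and> t < 1"
  using eventually_at_right_real[of 0 1] by (auto elim: eventually_mono)

text \<open>
  The point is that \<open>x\<close> and \<open>y\<close> may lie on the boundary of \<open>Q\<close>. Applying the inequality of a
  prox-function at an interior point \<open>p\<close> of a segment towards both of its ends gives the quadratic improvement of Jensen's inequality at \<open>p\<close>;
  letting \<open>p\<close> tend to \<open>x\<close> turns it into the claim for interior \<open>y\<close>, and a boundary point \<open>y\<close> is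
  then approached from the interior.
\<close>

lemma bregman_ge:
  assumes prox: "prox_function Q d D" and int: "interior Q \<noteq> {}" and x: "x \<in> Q" and y: "y \<in> Q"
  shows "1 / 2 * (norm (y - x))\<^sup>2 \<le> bregman d D x y"
proof -
  have Q: "convex Q" using prox by (simp add: prox_function_def convex_on_def)
  have der: "(d has_derivative blinfun_apply (D x)) (at x within Q)" if "x \<in> Q" for x
    using prox that by (simp add: prox_function_def)
  have st: "d p + D p (q - p) + 1 / 2 * (norm (q - p))\<^sup>2 \<le> d q" if "p \<in> interior Q" "q \<in> Q" for p q
    using prox that by (simp add: prox_function_def)
  have int_case: "1 / 2 * (norm (y - x))\<^sup>2 \<le> bregman d D x y" if y: "y \<in> interior Q" for y
  proof -
    have yQ: "y \<in> Q" using y interior_subset by blast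
    have le: "(d (x + t *\<^sub>R (y - x)) - d x) / t \<le> d y - d x - (1 - t) / 2 * (norm (y - x))\<^sup>2"
      if t: "0 < t" "t < 1" for t
    proof -
      define p where "p = x + t *\<^sub>R (y - x)"
      have p: "p \<in> interior Q" using convex_interior_segment[OF Q x y, of t] t by (simp add: p_def)
      have xp: "x - p = (- t) *\<^sub>R (y - x)" and yp: "y - p = (1 - t) *\<^sub>R (y - x)"
        by (simp_all add: p_def algebra_simps)
      have 1: "d p + (- t) * D p (y - x) + 1 / 2 * (t\<^sup>2 * (norm (y - x))\<^sup>2) \<le> d x"
        using st[OF p x] unfolding xp by (simp add: blinfun.scaleR_right power_mult_distrib blinfun.minus_right)
      have 2: "d p + (1 - t) * D p (y - x) + 1 / 2 * ((1 - t)\<^sup>2 * (norm (y - x))\<^sup>2) \<le> d y"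
        using st[OF p yQ] t unfolding yp by (simp add: blinfun.scaleR_right power_mult_distrib)
      let ?n = "(norm (y - x))\<^sup>2"
      have ident: "P + t * ((1 - t) / 2 * N) = (1 - t) * (P + (- t) * E + 1 / 2 * (t\<^sup>2 * N))
            + t * (P + (1 - t) * E + 1 / 2 * ((1 - t)\<^sup>2 * N))" for P E N :: real
        by (simp add: field_simps power2_eq_square)
      have "d p + t * ((1 - t) / 2 * ?n)
          = (1 - t) * (d p + (- t) * D p (y - x) + 1 / 2 * (t\<^sup>2 * ?n))
            + t * (d p + (1 - t) * D p (y - x) + 1 / 2 * ((1 - t)\<^sup>2 * ?n))"
        by (rule ident)
      also have "\<dots> \<le> (1 - t) * d x + t * d y"
        using t by (intro add_mono mult_left_mono 1 2) auto
      finally have "d p - d x \<le> t * (d y - d x - (1 - t) / 2 * ?n)"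
        by argo
      then show ?thesis using t by (simp add: p_def pos_divide_le_eq mult.commute)
    qed
    have "((\<lambda>t. d y - d x - (1 - t) / 2 * (norm (y - x))\<^sup>2) \<longlongrightarrow> d y - d x - (1 - 0) / 2 * (norm (y - x))\<^sup>2) (at_right 0)"
      by (intro tendsto_intros) auto
    from tendsto_le[OF _ this directional_derivative_within[OF Q der[OF x] x yQ]]
    have "D x (y - x) \<le> d y - d x - (1 - 0) / 2 * (norm (y - x))\<^sup>2"
      using eventually_mono[OF eventually_at_right_01 le] by (auto simp: case_prod_beta)
    then show ?thesis by (simp add: bregman_def)
  qed
  obtain z where z: "z \<in> interior Q" using int by blast
  let ?p = "\<lambda>t::real. y + t *\<^sub>R (z - y)"
  have p: "?p t \<in> interior Q" if "0 < t" "t < 1" for t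
    using convex_interior_segment[OF Q y z, of t] that by simp
  have ev: "\<forall>\<^sub>F t in at_right 0. 1 / 2 * (norm (?p t - x))\<^sup>2 \<le> bregman d D x (?p t)"
    using eventually_at_right_01 by eventually_elim (intro int_case p, auto)
  have pt: "(?p \<longlongrightarrow> y + 0 *\<^sub>R (z - y)) (at_right 0)" by (intro tendsto_intros)
  have "((\<lambda>t. d (?p t)) \<longlongrightarrow> d y) (at_right 0)"
  proof -
    have "((\<lambda>t. d y + t * ((d (?p t) - d y) / t)) \<longlongrightarrow> d y + 0 * D y (z - y)) (at_right 0)"
      using z interior_subset
      by (intro tendsto_intros directional_derivative_within[OF Q der[OF y] y]) auto
    moreover have "\<forall>\<^sub>F t in at_right 0. d y + t * ((d (?p t) - d y) / t) = d (?p t)"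
      using eventually_at_right_01 by eventually_elim simp
    ultimately show ?thesis by (simp add: Lim_transform_eventually)
  qed
  then have L1: "((\<lambda>t. bregman d D x (?p t)) \<longlongrightarrow> d y - d x - D x (y + 0 *\<^sub>R (z - y) - x)) (at_right 0)"
    unfolding bregman_def by (intro tendsto_intros pt)
  have L2: "((\<lambda>t. 1 / 2 * (norm (?p t - x))\<^sup>2) \<longlongrightarrow> 1 / 2 * (norm (y + 0 *\<^sub>R (z - y) - x))\<^sup>2) (at_right 0)"
    by (intro tendsto_intros pt)
  have "1 / 2 * (norm (y + 0 *\<^sub>R (z - y) - x))\<^sup>2 \<le> d y - d x - D x (y + 0 *\<^sub>R (z - y) - x)"
    by (rule tendsto_le[OF _ L1 L2 ev]) simp
  then show ?thesis by (simp add: bregman_def)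
qed

text \<open>
  First-order optimality: \<open>- D v\<close> is a subgradient of \<open>h\<close> at a minimiser \<open>v\<close> of \<open>d + h\<close>, so that
  the growth of \<open>d + h\<close> away from \<open>v\<close> is at least that of \<open>d\<close> over its linearisation.
\<close>

lemma argmin_bregman:
  assumes prox: "prox_function Q d D" and h: "convex_on Q h"
    and v: "is_arg_min (\<lambda>z. d z + h z) (\<lambda>z. z \<in> Q) v" and x: "x \<in> Q"
  shows "d v + h v + bregman d D v x \<le> d x + h x"
proof -
  have Q: "convex Q" using h by (simp add: convex_on_def)
  have vQ: "v \<in> Q" and vmin: "\<And>z. z \<in> Q \<Longrightarrow> d v + h v \<le> d z + h z"
    using v by (auto simp: is_arg_min_def not_less)
  have le: "h v - h x \<le> (d (v + t *\<^sub>R (x - v)) - d v) / t" if t: "0 < t" "t < 1" for t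
  proof -
    have p: "v + t *\<^sub>R (x - v) = (1 - t) *\<^sub>R v + t *\<^sub>R x" by (simp add: algebra_simps)
    have "d v + h v \<le> d (v + t *\<^sub>R (x - v)) + h (v + t *\<^sub>R (x - v))"
      unfolding p using convexD_alt[OF Q vQ x, of t] t by (intro vmin) auto
    moreover have "h (v + t *\<^sub>R (x - v)) \<le> (1 - t) * h v + t * h x"
      unfolding p using convex_onD[OF h, of t v x] t vQ x by simp
    ultimately have "t * (h v - h x) \<le> d (v + t *\<^sub>R (x - v)) - d v" by (simp add: algebra_simps)
    then show ?thesis using t by (simp add: pos_le_divide_eq mult.commute)
  qed
  have "(d has_derivative blinfun_apply (D v)) (at v within Q)"
    using prox vQ by (simp add: prox_function_def)
  from tendsto_lowerbound[OF directional_derivative_within[OF Q this vQ x]]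
  have "h v - h x \<le> D v (x - v)"
    using eventually_mono[OF eventually_at_right_01 le] by auto
  then show ?thesis by (simp add: bregman_def)
qed

section \<open>Step coefficients\<close>

lemma stepsize_identities:
  fixes a A M \<tau> :: real
  assumes "0 < a" "0 \<le> A" "a\<^sup>2 = 1 / M * (A + a)" "0 < M" "\<tau> = a / (A + a)"
  shows "0 < \<tau>" "\<tau> \<le> 1" "\<tau>\<^sup>2 * (M * (A + a)) = 1" "a = \<tau> * (A + a)" "A = (1 - \<tau>) * (A + a)"
proof -
  have pos: "0 < A + a" using assms by simp
  show a: "a = \<tau> * (A + a)" using pos assms by simp
  then show "A = (1 - \<tau>) * (A + a)" by (simp add: algebra_simps)
  show "0 < \<tau>" "\<tau> \<le> 1" using pos assms(1,2) unfolding assms(5) by (auto simp: divide_le_eq)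
  have "M * a\<^sup>2 = A + a" using assms by simp
  then show "\<tau>\<^sup>2 * (M * (A + a)) = 1"
    using pos assms by (simp add: power_divide) (simp add: power2_eq_square field_simps)
qed

text \<open>Both equations say \<open>\<tau>\<^sup>2 * (M * A) = 1 - \<tau>\<close>, whose positive root cannot grow with \<open>M\<close>.\<close>

lemma stepsize_antimono:
  fixes a A M \<tau> :: real
  assumes 1: "0 < a" "a\<^sup>2 = 1 / M * (A + a)" "0 < M" "\<tau> = a / (A + a)"
    and 2: "0 < a'" "a'\<^sup>2 = 1 / M' * (A + a')" "M \<le> M'" "\<tau>' = a' / (A + a')"
    and A: "0 \<le> A"
  shows "\<tau>' \<le> \<tau>"
proof (rule ccontr)
  assume "\<not> \<tau>' \<le> \<tau>"
  note i = stepsize_identities[OF 1(1) A 1(2,3,4)]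
  note i' = stepsize_identities[OF 2(1) A 2(2) _ 2(4)]
  have M': "0 < M'" using 1 2 by simp
  have eq: "\<tau>\<^sup>2 * (M * A) = 1 - \<tau>" using i(3,5) by algebra
  have eq': "\<tau>'\<^sup>2 * (M' * A) = 1 - \<tau>'" using i'(3,5)[OF M'] by algebra
  have "\<tau>\<^sup>2 * (M * A) \<le> \<tau>'\<^sup>2 * (M' * A)"
    using i(1) \<open>\<not> \<tau>' \<le> \<tau>\<close> 1 2 A by (intro mult_mono power_mono) auto
  then show False using eq eq' \<open>\<not> \<tau>' \<le> \<tau>\<close> by simp
qed

lemma curvature_radius_sq:
  assumes "0 < t" "0 < D"
  shows "(2 * t powr (3 / 2) * D powr (1 / 2))\<^sup>2 = 4 * t ^ 3 * (D::real)"
  using assms by (simp add: power_mult_distrib powr_power powr_numeral)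

section \<open>The universal fast gradient method\<close>

locale ufgm =
  fixes f \<Psi> d :: "'a::real_normed_vector \<Rightarrow> real"
    and grad_f grad_d :: "'a \<Rightarrow> 'a \<Rightarrow>\<^sub>L real"
    and Q :: "'a set" and x0 :: 'a and L0 \<epsilon> :: real
    and \<phi> :: "nat \<Rightarrow> 'a \<Rightarrow> real" and i :: "nat \<Rightarrow> nat"
    and aT \<tau>T :: "nat \<Rightarrow> nat \<Rightarrow> real" and xT xhT yT :: "nat \<Rightarrow> nat \<Rightarrow> 'a"
    and a \<tau> A L :: "nat \<Rightarrow> real" and v x y :: "nat \<Rightarrow> 'a"
  assumes f_convex: "convex_on UNIV f"
    and f_not_affine: "\<not> is_affine f"
    and f_grad: "\<And>z. grad_f z \<in> subdifferential f z"
    and f_regular: "regularity_assumption f"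
    and Psi_convex: "convex_on Q \<Psi>"
    and Q_interior: "interior Q \<noteq> {}"
    and d_prox: "prox_function Q d grad_d"
    and x0_in: "x0 \<in> Q"
    and eps_pos: "0 < \<epsilon>" and L0_pos: "0 < L0"
    and L0_bound: "L0 \<le> 2 * gamma_gauge f \<epsilon>"
    and run: "ufgm_run f grad_f \<Psi> Q d grad_d x0 L0 \<epsilon> \<phi> v i aT \<tau>T xT xhT yT a \<tau> x y A L"
begin

lemma Q_convex: "convex Q" using Psi_convex by (simp add: convex_on_def)

lemma subgradient: "f z + grad_f z (w - z) \<le> f w"
  using f_grad[of z] by (simp add: subdifferential_def)

lemma start: "\<phi> 0 z = bregman d grad_d x0 z" "y 0 = x0" "A 0 = 0" "L 0 = L0"
  using run by (auto simp: ufgm_run_def)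

lemma v_argmin: "is_arg_min (\<phi> k) (\<lambda>z. z \<in> Q) (v k)"
  and trial: "j \<le> i k \<Longrightarrow> ufgm_trial grad_f \<Psi> Q d grad_d (v k) (y k) (A k) (L k) j
                 (aT k j) (\<tau>T k j) (xT k j) (xhT k j) (yT k j)"
  and accepted: "ufgm_accept f grad_f \<epsilon> (L k) (i k) (\<tau> k) (x (Suc k)) (y (Suc k))"
  and rejected: "j < i k \<Longrightarrow> \<not> ufgm_accept f grad_f \<epsilon> (L k) j (\<tau>T k j) (xT k j) (yT k j)"
  and A_Suc: "A (Suc k) = A k + a (Suc k)"
  and L_Suc: "L (Suc k) = 2 ^ i k * L k"
  and \<phi>_Suc: "\<phi> (Suc k) z = \<phi> k z + a (Suc k) *
                (f (x (Suc k)) + grad_f (x (Suc k)) (z - x (Suc k)) + \<Psi> z)"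
  and accepted_trial: "ufgm_trial grad_f \<Psi> Q d grad_d (v k) (y k) (A k) (L k) (i k)
                 (a (Suc k)) (\<tau> k) (x (Suc k)) (xhT k (i k)) (y (Suc k))"
  using run by (auto simp: ufgm_run_def)

lemma a_pos: "0 < a (Suc k)"
  using accepted_trial[of k] by (simp add: ufgm_trial_def)

lemma L_pos: "0 < L k"
  by (induction k) (auto simp: start L0_pos L_Suc)

lemma A_nonneg: "0 \<le> A k"
  by (induction k) (auto simp: start A_Suc intro: add_nonneg_nonneg less_imp_le[OF a_pos])

lemma A_pos: "0 < A (Suc k)"
  using A_nonneg[of k] a_pos[of k] by (simp add: A_Suc)

lemma accept_iff:
  "ufgm_accept f grad_f \<epsilon> M j t X Y \<longleftrightarrow>
     f Y \<le> f X + grad_f X (Y - X) + (2 ^ j * M) / 2 * (norm (Y - X))\<^sup>2 + \<epsilon> * t / 2"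
  by (simp add: ufgm_accept_def power_int_diff)

lemma stepsizes:
  shows \<tau>_pos: "0 < \<tau> k" and \<tau>_le_1: "\<tau> k \<le> 1"
    and \<tau>_L_A: "(\<tau> k)\<^sup>2 * (L (Suc k) * A (Suc k)) = 1"
    and a_eq: "a (Suc k) = \<tau> k * A (Suc k)" and A_eq: "A k = (1 - \<tau> k) * A (Suc k)"
proof -
  have tr: "0 < a (Suc k)" "(a (Suc k))\<^sup>2 = 1 / L (Suc k) * (A k + a (Suc k))"
    "\<tau> k = a (Suc k) / (A k + a (Suc k))"
    using accepted_trial[of k] unfolding ufgm_trial_def L_Suc by blast+
  note ids = stepsize_identities[OF tr(1) A_nonneg tr(2) L_pos tr(3), folded A_Suc]
  show "0 < \<tau> k" by (fact ids(1))
  show "\<tau> k \<le> 1" by (fact ids(2))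
  show "(\<tau> k)\<^sup>2 * (L (Suc k) * A (Suc k)) = 1" by (fact ids(3))
  show "a (Suc k) = \<tau> k * A (Suc k)" by (fact ids(4))
  show "A k = (1 - \<tau> k) * A (Suc k)" by (fact ids(5))
qed

text \<open>
  The constants \<open>L\<close> never decrease, so the identity \<open>\<tau>\<^sup>2 L A = 1\<close> at two consecutive steps gives
  \<open>1 / \<tau>\<^sub>k\<^sup>2 \<le> (1 - t) / t\<^sup>2\<close> for \<open>t = \<tau>\<^bsub>k+1\<^esub>\<close>, and \<open>1 - t \<le> (1 - t/2)\<^sup>2\<close>.
\<close>

lemma inverse_\<tau>_step: "1 / \<tau> k + 1 / 2 \<le> 1 / \<tau> (Suc k)"
proof -
  define s t where "s = \<tau> k" and "t = \<tau> (Suc k)"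
  have s: "0 < s" and t: "0 < t" "t \<le> 1" using \<tau>_pos \<tau>_le_1 by (simp_all add: s_def t_def)
  have LA: "s\<^sup>2 * (L (Suc k) * A (Suc k)) = 1" using \<tau>_L_A[of k] by (simp add: s_def)
  have "t\<^sup>2 * (L (Suc k) * A (Suc k)) \<le> t\<^sup>2 * (L (Suc (Suc k)) * A (Suc k))"
  proof (intro mult_left_mono mult_right_mono)
    have "1 * L (Suc k) \<le> 2 ^ i (Suc k) * L (Suc k)"
      using L_pos[of "Suc k"] by (intro mult_right_mono) auto
    then show "L (Suc k) \<le> L (Suc (Suc k))" by (simp add: L_Suc[of "Suc k"])
  qed (simp_all add: A_nonneg)
  also have "\<dots> = (1 - t) * (t\<^sup>2 * (L (Suc (Suc k)) * A (Suc (Suc k))))"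
    unfolding A_eq[of "Suc k"] t_def by (simp only: mult_ac)
  also have "\<dots> = 1 - t" using \<tau>_L_A[of "Suc k"] by (simp add: t_def)
  finally have "s\<^sup>2 * (t\<^sup>2 * (L (Suc k) * A (Suc k))) \<le> s\<^sup>2 * (1 - t)"
    by (intro mult_left_mono) auto
  then have "t\<^sup>2 * (s\<^sup>2 * (L (Suc k) * A (Suc k))) \<le> s\<^sup>2 * (1 - t)"
    by (simp only: mult.left_commute)
  then have "t\<^sup>2 \<le> s\<^sup>2 * (1 - t)" by (simp add: LA)
  also have "\<dots> \<le> s\<^sup>2 * (1 - t / 2)\<^sup>2"
    by (intro mult_left_mono) (simp_all add: power2_eq_square algebra_simps)
  finally have "t\<^sup>2 \<le> (s * (1 - t / 2))\<^sup>2" by (simp only: power_mult_distrib)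
  then have "t \<le> s * (1 - t / 2)" by (rule power2_le_imp_le) (use s t in simp)
  then have "t / s \<le> 1 - t / 2" using s by (simp add: pos_divide_le_eq mult.commute)
  then have "1 / s \<le> (1 - t / 2) / t" using t by (simp add: pos_le_divide_eq mult.commute)
  then have "1 / s + 1 / 2 \<le> 1 / t" using t by (simp add: diff_divide_distrib)
  then show ?thesis by (simp add: s_def t_def)
qed

lemma \<tau>_decreasing: "\<tau> (Suc k) \<le> \<tau> k"
proof -
  have "1 / \<tau> k \<le> 1 / \<tau> (Suc k)" using inverse_\<tau>_step[of k] by simp
  then show ?thesis using \<tau>_pos[of k] \<tau>_pos[of "Suc k"] by (simp add: field_simps)
qed

lemma \<tau>_le: "\<tau> k \<le> 2 / (real k + 2)"
proof -
  have "(real k + 2) / 2 \<le> 1 / \<tau> k"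
  proof (induction k)
    case 0
    then show ?case using \<tau>_pos[of 0] \<tau>_le_1[of 0] by simp
  next
    case (Suc k)
    then show ?case using inverse_\<tau>_step[of k] by (simp add: field_simps)
  qed
  then show ?thesis using \<tau>_pos[of k] by (simp add: field_simps)
qed

text \<open>
  If the line search has doubled \<open>L\<close> at step \<open>k\<close>, its last rejected trial used \<open>L\<^bsub>k+1\<^esub> / 2\<close> and a
  coefficient at least \<open>\<tau>\<^sub>k\<close>, hence \<open>L\<^bsub>k+1\<^esub> / 2\<close> is below the gauge. Otherwise \<open>L\<close> is inherited
  from the previous step, or from \<open>L0\<close> when \<open>k = 0\<close>, and the right-hand side has only grown since, as the
  gauge is decreasing and so is \<open>\<tau>\<close>.
\<close>

lemma L_le_gamma: "L (Suc k) \<le> 2 * gamma_gauge f (\<epsilon> * \<tau> k)"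
proof (induction k)
  note anti = gamma_gauge_antimono[OF f_regular f_convex f_not_affine f_grad]
  have searched: "L (Suc k) \<le> 2 * gamma_gauge f (\<epsilon> * \<tau> k)" if "i k = Suc j" for k j
  proof -
    have tr: "ufgm_trial grad_f \<Psi> Q d grad_d (v k) (y k) (A k) (L k) j
                 (aT k j) (\<tau>T k j) (xT k j) (xhT k j) (yT k j)"
      using trial[of j k] that by simp
    have "\<tau> k \<le> \<tau>T k j"
    proof (rule stepsize_antimono)
      show "2 ^ j * L k \<le> 2 ^ i k * L k" using L_pos[of k] that by simp
    qed (use tr accepted_trial[of k] A_nonneg[of k] L_pos[of k] in \<open>auto simp: ufgm_trial_def\<close>)
    moreover have "\<not> gamma_gauge f (\<epsilon> * \<tau>T k j) \<le> 2 ^ j * L k"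
      using rejected[of j k] that gauge_quadratic_model[OF f_regular f_convex f_not_affine f_grad f_grad]
        eps_pos \<tau>_pos[of k] \<open>\<tau> k \<le> \<tau>T k j\<close> unfolding accept_iff by force
    ultimately have "2 ^ j * L k \<le> gamma_gauge f (\<epsilon> * \<tau> k)"
      using anti[of "\<epsilon> * \<tau> k" "\<epsilon> * \<tau>T k j"] eps_pos \<tau>_pos[of k] by simp
    then show ?thesis by (simp add: L_Suc that)
  qed
  {
    case 0
    show ?case
    proof (cases "i 0")
      case 0
      have "L (Suc 0) \<le> 2 * gamma_gauge f \<epsilon>" using 0 L0_bound by (simp add: L_Suc start)
      also have "\<dots> \<le> 2 * gamma_gauge f (\<epsilon> * \<tau> 0)"
        using anti[of "\<epsilon> * \<tau> 0" \<epsilon>] eps_pos \<tau>_pos[of 0] \<tau>_le_1[of 0] by simp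
      finally show ?thesis .
    qed (rule searched)
  next
    case (Suc k)
    show ?case
    proof (cases "i (Suc k)")
      case 0
      have "L (Suc (Suc k)) \<le> 2 * gamma_gauge f (\<epsilon> * \<tau> k)" using 0 Suc by (simp add: L_Suc)
      also have "\<dots> \<le> 2 * gamma_gauge f (\<epsilon> * \<tau> (Suc k))"
        using anti[of "\<epsilon> * \<tau> (Suc k)" "\<epsilon> * \<tau> k"] eps_pos \<tau>_pos[of "Suc k"] \<tau>_decreasing[of k] by simp
      finally show ?thesis .
    qed (rule searched)
  }
qed

text \<open>
  For \<open>\<mu>(s) = \<epsilon> \<tau>\<^sub>k / 2\<close>, inserting both upper bounds into \<open>\<tau>\<^sub>k\<^sup>2 L\<^bsub>k+1\<^esub> A\<^bsub>k+1\<^esub> = 1\<close> leaves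
  \<open>s\<^sup>2 \<le> 4 \<tau>\<^sub>k\<^sup>3 D\<close>.
\<close>

lemma small_A_imp_large_curvature:
  assumes A: "A (Suc k) \<le> 2 / \<epsilon> * D"
  shows "\<epsilon> * \<tau> k / 2 \<le> curv f (2 * \<tau> k powr (3 / 2) * D powr (1 / 2))"
proof -
  define s R where "s = complexity_gauge f (\<epsilon> * \<tau> k / 2)" and "R = 2 * \<tau> k powr (3 / 2) * D powr (1 / 2)"
  have s: "0 < s" "curv f s = \<epsilon> * \<tau> k / 2"
    using complexity_gauge_inverse[OF f_regular f_convex f_not_affine f_grad, of "\<epsilon> * \<tau> k / 2"] eps_pos \<tau>_pos[of k]
    by (auto simp: s_def)
  have "0 < 2 / \<epsilon> * D" using A A_pos[of k] by linarith
  then have D: "0 < D" using eps_pos by (simp add: zero_less_divide_iff)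
  have "1 = (\<tau> k)\<^sup>2 * (L (Suc k) * A (Suc k))" using \<tau>_L_A by simp
  also have "\<dots> \<le> (\<tau> k)\<^sup>2 * (2 * (\<epsilon> * \<tau> k / s\<^sup>2) * (2 / \<epsilon> * D))"
    using L_le_gamma[of k] A L_pos[of "Suc k"] A_nonneg[of "Suc k"] eps_pos \<tau>_pos[of k]
    by (intro mult_left_mono mult_mono) (auto simp: gamma_gauge_def s_def)
  also have "\<dots> = R\<^sup>2 / s\<^sup>2"
    unfolding R_def curvature_radius_sq[OF \<tau>_pos D] using eps_pos by (simp add: power2_eq_square power3_eq_cube)
  finally have "s\<^sup>2 \<le> R\<^sup>2" using s by (simp add: pos_le_divide_eq)
  then have "s \<le> R" by (rule power2_le_imp_le) (simp add: R_def)
  then show ?thesis using curv_mono[OF f_regular, of s R] s by (simp add: R_def)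
qed

text \<open>
  With \<open>q = \<tau>\<^sub>k / T < 1\<close> for \<open>T = 2 / (k + 1)\<close>, the radius belonging to \<open>\<tau>\<^sub>k\<close> is \<open>q powr (3/2)\<close>
  times the radius belonging to \<open>T\<close>, and \<open>\<mu>\<close> shrinks at least by the same factor. So \<open>\<mu>\<close> is at
  most \<open>q powr (3/2) * \<epsilon> T / 2\<close> there, whereas a small \<open>A\<^bsub>k+1\<^esub>\<close> would make it at least
  \<open>q * \<epsilon> T / 2\<close>.
\<close>

lemma small_curvature_imp_large_A:
  assumes C: "(real k + 1) * curv f (2 * (2 / (real k + 1)) powr (3 / 2) * D powr (1 / 2)) \<le> \<epsilon>"
  shows "2 / \<epsilon> * D \<le> A (Suc k)"
proof (rule ccontr)
  assume "\<not> 2 / \<epsilon> * D \<le> A (Suc k)"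
  then have low: "\<epsilon> * \<tau> k / 2 \<le> curv f (2 * \<tau> k powr (3 / 2) * D powr (1 / 2))"
    by (intro small_A_imp_large_curvature) simp
  define T where "T = 2 / (real k + 1)"
  define q where "q = \<tau> k / T"
  have T: "0 < T" by (simp add: T_def)
  have "\<tau> k < T" using \<tau>_le[of k] by (rule le_less_trans) (simp add: T_def field_simps)
  then have q: "0 < q" "q < 1" using \<tau>_pos[of k] T by (auto simp: q_def)
  have \<tau>: "\<tau> k = q * T" using T by (simp add: q_def)
  have q32: "q powr (3 / 2) < q" using powr_less_mono'[of q 1 "3/2"] q by simp
  have "curv f (2 * \<tau> k powr (3 / 2) * D powr (1 / 2))
      = curv f (q powr (3 / 2) * (2 * T powr (3 / 2) * D powr (1 / 2)))"
    using q T by (simp add: \<tau> powr_mult mult_ac)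
  also have "\<dots> \<le> q powr (3 / 2) * curv f (2 * T powr (3 / 2) * D powr (1 / 2))"
    using q q32 by (intro curv_scale_le f_regular f_convex) auto
  also have "\<dots> \<le> q powr (3 / 2) * (\<epsilon> * T / 2)"
    using C by (intro mult_left_mono) (auto simp: T_def field_simps)
  also have "\<dots> < q * (\<epsilon> * T / 2)" using q32 eps_pos T by (intro mult_strict_right_mono) auto
  also have "\<dots> = \<epsilon> * \<tau> k / 2" by (simp add: \<tau>)
  finally show False using low by simp
qed

lemma y_in: "y k \<in> Q"
proof (induction k)
  case 0
  then show ?case by (simp add: start x0_in)
next
  case (Suc k)
  have "y (Suc k) = (1 - \<tau> k) *\<^sub>R y k + \<tau> k *\<^sub>R xhT k (i k)" "xhT k (i k) \<in> Q"
    using accepted_trial[of k] by (auto simp: ufgm_trial_def is_arg_min_def)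
  then show ?case using convexD_alt[OF Q_convex Suc, of "xhT k (i k)" "\<tau> k"] \<tau>_pos[of k] \<tau>_le_1[of k]
    by simp
qed

lemma convex_on_affine: "convex_on Q (\<lambda>z. c + blinfun_apply g (z - w))"
proof -
  have "c + g (\<mu> *\<^sub>R p + (1 - \<mu>) *\<^sub>R q - w) = \<mu> * (c + g (p - w)) + (1 - \<mu>) * (c + g (q - w))" for p q \<mu>
    by (simp add: blinfun.diff_right blinfun.add_right blinfun.scaleR_right) (simp add: algebra_simps)
  then show ?thesis unfolding convex_on_alt using Q_convex by simp
qed

lemma estimate_minus_prox_convex: "convex_on Q (\<lambda>z. \<phi> k z - d z)"
proof (induction k)
  case 0
  have "(\<lambda>z. \<phi> 0 z - d z) = (\<lambda>z. - d x0 + blinfun_apply (- grad_d x0) (z - x0))"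
    by (simp add: start bregman_def blinfun.minus_left)
  then show ?case using convex_on_affine by (simp only:)
next
  case (Suc k)
  have "convex_on Q (\<lambda>z. (\<phi> k z - d z) + a (Suc k) *
                ((f (x (Suc k)) + grad_f (x (Suc k)) (z - x (Suc k))) + \<Psi> z))"
    by (rule convex_on_add[OF Suc convex_on_cmul[OF less_imp_le[OF a_pos]
          convex_on_add[OF convex_on_affine Psi_convex]]])
  then show ?case by (simp add: \<phi>_Suc add_diff_eq diff_add_eq)
qed

lemma estimate_growth:
  assumes "z \<in> Q" shows "\<phi> k (v k) + bregman d grad_d (v k) z \<le> \<phi> k z"
  using argmin_bregman[OF d_prox estimate_minus_prox_convex[of k] _ assms, of "v k"] v_argmin[of k]
  by simp

text \<open>Each step adds to \<open>\<phi>\<close> a multiple of \<open>\<Psi>\<close> plus a linear minorant of \<open>f\<close>.\<close>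

lemma estimate_upper:
  "z \<in> Q \<Longrightarrow> \<phi> k z \<le> A k * (f z + \<Psi> z) + bregman d grad_d x0 z"
proof (induction k)
  case 0
  then show ?case by (simp add: start)
next
  case (Suc k)
  have "a (Suc k) * (f (x (Suc k)) + grad_f (x (Suc k)) (z - x (Suc k)) + \<Psi> z) \<le> a (Suc k) * (f z + \<Psi> z)"
    using a_pos[of k] subgradient by (intro mult_left_mono add_right_mono) auto
  then show ?case using Suc by (simp add: \<phi>_Suc A_Suc algebra_simps)
qed

text \<open>
  The growth of \<open>\<phi>\<^sub>k\<close> away from \<open>v\<^sub>k\<close> makes \<open>\<phi>\<^bsub>k+1\<^esub>\<close> exceed \<open>\<phi>\<^sub>k(v\<^sub>k)\<close> by at least the auxiliary
  objective, up to its omitted constant term, and that objective is minimal at \<open>xh\<close>.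
  There the Bregman distance dominates half the squared distance of \<open>xh\<close> and \<open>v\<^sub>k\<close>, which
  is exactly the quadratic term of the acceptance test times \<open>A\<^bsub>k+1\<^esub>\<close>, because \<open>Y - X\<close> is
  \<open>\<tau>\<^sub>k (xh - v\<^sub>k)\<close> and \<open>\<tau>\<^sub>k\<^sup>2 L\<^bsub>k+1\<^esub> A\<^bsub>k+1\<^esub> = 1\<close>. The linear terms at \<open>xh\<close> and \<open>y\<^sub>k\<close> combine to the
  one at \<open>Y\<close>.
\<close>

lemma estimate_lower:
  "A k * (f (y k) + \<Psi> (y k)) - \<epsilon> / 2 * A k \<le> \<phi> k (v k)"
proof (induction k)
  case 0
  have "v 0 \<in> Q" using v_argmin[of 0] by (simp add: is_arg_min_def)
  then have "1 / 2 * (norm (v 0 - x0))\<^sup>2 \<le> bregman d grad_d x0 (v 0)"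
    by (rule bregman_ge[OF d_prox Q_interior x0_in])
  then have "0 \<le> bregman d grad_d x0 (v 0)" by (rule order_trans[rotated]) simp
  then show ?case by (simp add: start)
next
  case (Suc k)
  define X Y w xh g t A1 where "X = x (Suc k)" and "Y = y (Suc k)" and "w = v (Suc k)" and "xh = xhT k (i k)"
    and "g = grad_f X" and "t = \<tau> k" and "A1 = A (Suc k)"
  have A1: "0 \<le> A1" "A k = (1 - t) * A1" "a (Suc k) = t * A1" and t: "0 < t" "t \<le> 1"
    using A_nonneg[of "Suc k"] A_eq[of k] a_eq[of k] \<tau>_pos[of k] \<tau>_le_1[of k] by (auto simp: A1_def t_def)
  have w: "w \<in> Q" and vQ: "v k \<in> Q" using v_argmin by (auto simp: is_arg_min_def w_def)
  have X: "X = t *\<^sub>R v k + (1 - t) *\<^sub>R y k" and Y: "Y = t *\<^sub>R xh + (1 - t) *\<^sub>R y k"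
    and xh: "is_arg_min (\<lambda>z. bregman d grad_d (v k) z + a (Suc k) * (g z + \<Psi> z)) (\<lambda>z. z \<in> Q) xh"
    using accepted_trial[of k] by (auto simp: ufgm_trial_def X_def Y_def xh_def t_def g_def)
  have xhQ: "xh \<in> Q" and xh_le: "bregman d grad_d (v k) xh + a (Suc k) * (g xh + \<Psi> xh)
      \<le> bregman d grad_d (v k) w + a (Suc k) * (g w + \<Psi> w)"
    using xh w by (auto simp: is_arg_min_def not_less)
  have model: "f Y \<le> f X + g (Y - X) + L (Suc k) / 2 * (norm (Y - X))\<^sup>2 + \<epsilon> * t / 2"
    using accepted[of k] unfolding accept_iff L_Suc[symmetric] by (simp add: X_def Y_def g_def t_def)
  have YX: "Y - X = t *\<^sub>R (xh - v k)" by (simp add: X Y algebra_simps)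
  have "A1 * (L (Suc k) / 2 * (norm (Y - X))\<^sup>2) = (t\<^sup>2 * (L (Suc k) * A1)) * (1 / 2 * (norm (xh - v k))\<^sup>2)"
    unfolding YX by (simp add: power_mult_distrib mult_ac)
  also have "\<dots> = 1 / 2 * (norm (xh - v k))\<^sup>2" using \<tau>_L_A[of k] by (simp add: t_def A1_def)
  also have "\<dots> \<le> bregman d grad_d (v k) xh" by (rule bregman_ge[OF d_prox Q_interior vQ xhQ])
  finally have quad: "A1 * (L (Suc k) / 2 * (norm (Y - X))\<^sup>2) \<le> bregman d grad_d (v k) xh" .
  have lin: "g (Y - X) = t * g (xh - X) + (1 - t) * g (y k - X)"
    unfolding Y by (simp add: blinfun.diff_right blinfun.add_right blinfun.scaleR_right algebra_simps)
  have psi: "\<Psi> Y \<le> (1 - t) * \<Psi> (y k) + t * \<Psi> xh"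
    using convex_onD[OF Psi_convex, of t "y k" xh] t y_in[of k] xhQ by (simp add: Y add.commute)
  have sub: "f X + g (y k - X) \<le> f (y k)" using subgradient by (simp add: g_def)
  have "A1 * (f Y + \<Psi> Y) - \<epsilon> / 2 * A1
      \<le> A1 * ((f X + (t * g (xh - X) + (1 - t) * g (y k - X)) + L (Suc k) / 2 * (norm (Y - X))\<^sup>2 + \<epsilon> * t / 2)
          + ((1 - t) * \<Psi> (y k) + t * \<Psi> xh)) - \<epsilon> / 2 * A1"
    by (rule diff_right_mono[OF mult_left_mono[OF add_mono[OF model[unfolded lin] psi] A1(1)]])
  also have "\<dots> = (1 - t) * A1 * ((f X + g (y k - X)) + \<Psi> (y k)) - \<epsilon> / 2 * ((1 - t) * A1)
       + A1 * (L (Suc k) / 2 * (norm (Y - X))\<^sup>2) + t * A1 * (f X + g (xh - X) + \<Psi> xh)"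
  proof -
    have "A1 * ((F + (t * p + (1 - t) * q) + n + \<epsilon> * t / 2) + ((1 - t) * P + t * P')) - \<epsilon> / 2 * A1
        = (1 - t) * A1 * ((F + q) + P) - \<epsilon> / 2 * ((1 - t) * A1) + A1 * n + t * A1 * (F + p + P')"
      for F p q n P P' by (simp add: field_simps)
    then show ?thesis .
  qed
  also have "\<dots> \<le> (1 - t) * A1 * (f (y k) + \<Psi> (y k)) - \<epsilon> / 2 * ((1 - t) * A1)
       + bregman d grad_d (v k) xh + t * A1 * (f X + g (xh - X) + \<Psi> xh)"
    using A1 t by (intro add_right_mono add_mono[OF diff_right_mono quad] mult_left_mono sub) simp
  also have "\<dots> \<le> \<phi> k (v k) + (bregman d grad_d (v k) xh + a (Suc k) * (f X + g (xh - X) + \<Psi> xh))"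
    using Suc.IH by (simp add: A1)
  also have "\<dots> \<le> \<phi> k (v k) + (bregman d grad_d (v k) w + a (Suc k) * (f X + g (w - X) + \<Psi> w))"
    using xh_le by (simp add: blinfun.diff_right algebra_simps)
  also have "\<dots> \<le> \<phi> (Suc k) w"
    using estimate_growth[OF w, of k] by (simp add: \<phi>_Suc X_def g_def)
  finally show ?case by (simp add: A1_def Y_def w_def)
qed

lemma objective_gap_le:
  assumes z: "z \<in> Q" and A: "2 / \<epsilon> * bregman d grad_d x0 z \<le> A (Suc k)"
  shows "(f (y (Suc k)) + \<Psi> (y (Suc k))) - (f z + \<Psi> z) \<le> \<epsilon>"
proof -
  let ?A = "A (Suc k)"
  have "\<phi> (Suc k) (v (Suc k)) \<le> \<phi> (Suc k) z"
    using v_argmin[of "Suc k"] z by (auto simp: is_arg_min_def not_less)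
  then have "?A * (f (y (Suc k)) + \<Psi> (y (Suc k))) - \<epsilon> / 2 * ?A \<le> ?A * (f z + \<Psi> z) + bregman d grad_d x0 z"
    using estimate_lower[of "Suc k"] estimate_upper[OF z, of "Suc k"] by linarith
  moreover have "bregman d grad_d x0 z \<le> \<epsilon> / 2 * ?A" using A eps_pos by (simp add: field_simps)
  ultimately have "?A * ((f (y (Suc k)) + \<Psi> (y (Suc k))) - (f z + \<Psi> z)) \<le> ?A * \<epsilon>"
    by (simp add: algebra_simps)
  then show ?thesis using A_pos[of k] by (simp only: mult_le_cancel_left_pos)
qed

end

theorem theorem7:
  fixes f \<Psi> d :: "'a::real_normed_vector \<Rightarrow> real"
    and grad_f grad_d :: "'a \<Rightarrow> 'a \<Rightarrow>\<^sub>L real"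
    and dom\<Psi> :: "'a set"
    and x0 xstar :: 'a
    and L0 \<epsilon> D :: real
    and \<phi> :: "nat \<Rightarrow> 'a \<Rightarrow> real"
    and i :: "nat \<Rightarrow> nat"
    and aT \<tau>T :: "nat \<Rightarrow> nat \<Rightarrow> real"
    and xT xhT yT :: "nat \<Rightarrow> nat \<Rightarrow> 'a"
    and a \<tau> A L :: "nat \<Rightarrow> real"
    and v x y :: "nat \<Rightarrow> 'a"
  assumes fin_dim: "finite_dimensional TYPE('a)"
    and f_convex: "convex_on UNIV f"
    and f_not_affine: "\<not> is_affine f"
    and f_grad: "\<And>z. grad_f z \<in> subdifferential f z"
    and f_regular: "regularity_assumption f"
    and Psi_closed_convex: "closed_convex_on dom\<Psi> \<Psi>"
    and dom_interior: "interior dom\<Psi> \<noteq> {}"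
    and d_prox: "prox_function dom\<Psi> d grad_d"
    and x0_argmin: "is_arg_min d (\<lambda>z. z \<in> dom\<Psi>) x0"
    and d_x0: "d x0 = 0"
    and xstar_optimal: "is_arg_min (\<lambda>z. f z + \<Psi> z) (\<lambda>z. z \<in> dom\<Psi>) xstar"
    and eps_pos: "0 < \<epsilon>"
    and L0_pos: "0 < L0"
    and L0_bound: "L0 \<le> 2 * gamma_gauge f \<epsilon>"
    and run: "ufgm_run f grad_f \<Psi> dom\<Psi> d grad_d x0 L0 \<epsilon> \<phi> v i aT \<tau>T xT xhT yT a \<tau> x y A L"
    and D_def: "D = bregman d grad_d x0 xstar"
  shows "(\<forall>k. A (Suc k) \<le> 2 / \<epsilon> * D \<longrightarrow>
            ereal (2 / \<tau> k) * curvature_bound f (2 * \<tau> k powr (3 / 2) * D powr (1 / 2)) \<ge> ereal \<epsilon>) \<and>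
         (\<forall>k. ereal (real k + 1) *
                curvature_bound f (2 * (2 / (real k + 1)) powr (3 / 2) * D powr (1 / 2)) \<le> ereal \<epsilon> \<longrightarrow>
            A (Suc k) \<ge> 2 / \<epsilon> * D \<and>
            (f (y (Suc k)) + \<Psi> (y (Suc k))) - (f xstar + \<Psi> xstar) \<le> \<epsilon>)"
proof -
  interpret ufgm f \<Psi> d grad_f grad_d dom\<Psi> x0 L0 \<epsilon> \<phi> i aT \<tau>T xT xhT yT a \<tau> A L v x y
    using f_convex f_not_affine f_grad f_regular Psi_closed_convex dom_interior d_prox x0_argmin
      eps_pos L0_pos L0_bound run
    by unfold_locales (auto simp: closed_convex_on_def is_arg_min_def)
  have xstar: "xstar \<in> dom\<Psi>" using xstar_optimal by (simp add: is_arg_min_def)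
  have curv: "curvature_bound f (2 * t powr (3 / 2) * D powr (1 / 2))
      = ereal (curv f (2 * t powr (3 / 2) * D powr (1 / 2)))" for t
    by (rule curvature_bound_eq[OF f_regular]) simp
  show ?thesis
  proof (intro conjI allI impI)
    fix k assume "A (Suc k) \<le> 2 / \<epsilon> * D"
    then have "\<epsilon> \<le> 2 / \<tau> k * curv f (2 * \<tau> k powr (3 / 2) * D powr (1 / 2))"
      using small_A_imp_large_curvature[of k D] \<tau>_pos[of k] by (simp add: field_simps)
    then show "ereal \<epsilon> \<le> ereal (2 / \<tau> k) * curvature_bound f (2 * \<tau> k powr (3 / 2) * D powr (1 / 2))"
      by (simp only: curv times_ereal.simps ereal_less_eq)
  next
    fix k assume "ereal (real k + 1) *
      curvature_bound f (2 * (2 / (real k + 1)) powr (3 / 2) * D powr (1 / 2)) \<le> ereal \<epsilon>"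
    then show A: "2 / \<epsilon> * D \<le> A (Suc k)" by (intro small_curvature_imp_large_A) (simp add: curv)
    then show "f (y (Suc k)) + \<Psi> (y (Suc k)) - (f xstar + \<Psi> xstar) \<le> \<epsilon>"
      using objective_gap_le[OF xstar] by (simp add: D_def)
  qed
qed

end
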